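(* Let a consistent class of data with base $X$, locally compact space $Y$, Radon measure $\mu$ on $Y$, family $\{\mathfrak E_x\}_{x\in X}$, topologies $\{\tau_x\}_{x\in X}$, space $\langle\mathcal H,\mathfrak T\rangle$ and linear space $\mathcal A$ be given, and let $\mathfrak G$ be the locally convex space relative to it and $\Psi_Y^{\mathcal H}$ the associated map (see context). Let $D\subseteq\mathcal H$ and assume that for all $x\in X$ and all $v_x\in\Pr_x(D)$ the evaluation map $f\mapsto f(v_x)$ is continuous from $\langle\mathcal L(\mathfrak E_x),\tau_x\rangle$ to $\mathfrak E_x$. Then for all $\overline F\in\mathfrak L_1(Y,\mathfrak G,\mu)$, $x\in X$ and $v\in D$ $$\Bigl(\int\Pr_x(\Psi_Y^{\mathcal H}(\overline F))(s)\,d\mu(s)\Bigr)(v(x))=\Bigl(\Bigl(\int\overline F(s)\,d\mu(s)\Bigr)(v)\Bigr)(x),$$ where the integral on the left is with respect to the locally convex topology of $\langle\mathcal L(\mathfrak E_x),\tau_x\rangle$ and the one on the right with respect to that of $\mathfrak G$. Equivalently, $\mathfrak G$ is a $\mathsf U$-space with respect to $\{\langle\mathcal L(\mathfrak E_x),\tau_x\rangle\}_{x\in X}$, $\mathfrak T$ and $D$.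
   Context: Hlcs means Hausdorff locally convex space (over $\mathbb C$); $\mathcal L(E)$ denotes the continuous, $End(E)$ all linear endomorphisms of $E$. For $Y$ locally compact, $\mu$ a Radon measure, $E$ a Hlcs, $\mathfrak L_1(Y,E,\mu)$ is the space of scalarly essentially $\mu$-integrable maps $Y\to E$ whose (weak) integral belongs to $E$ (Bourbaki). For a family of vector spaces $\{Z_x\}_{x\in X}$, $\Pr_x:\prod_yZ_y\to Z_x$ is the projection and $\imath_x:Z_x\to\prod_yZ_y$ the canonical injection (zero in all other coordinates). Consistent class of data: a set $X$, a locally compact space $Y$ with a Radon measure $\mu$, Hlcs $\mathfrak E_x$ ($x\in X$) with fundamental sets of seminorms, topologies $\tau_x$ making $\langle\mathcal L(\mathfrak E_x),\tau_x\rangle$ a Hlcs (with fundamental sets of seminorms), and a Hlcs $\langle\mathcal H,\mathfrak T\rangle$ such that: $\mathcal H$ is a linear subspace of $\prod_x\mathfrak E_x$; $\imath_x(\mathfrak E_x)\subset\mathcal H$ for all $x$; $\Pr_x:\langle\mathcal H,\mathfrak T\rangle\to\mathfrak E_x$ and $\imath_x:\mathfrak E_x\to\langle\mathcal H,\mathfrak T\rangle$ are continuous for all $x$; and $\mathcal A\subseteq\prod_x\mathcal L(\mathfrak E_x)$ is a linear subspace with $\theta(u)|_{\mathcal H}\in\mathcal L(\langle\mathcal H,\mathfrak T\rangle)$ for all $u\in\mathcal A$ and $\imath_x(\mathcal L(\mathfrak E_x))\subseteq\mathcal A$ for all $x$. Here $\theta:\prod_xEnd(\mathfrak E_x)\to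 End(\prod_x\mathfrak E_x)$ is given by $\Pr_x\circ\theta(u)=\Pr_x(u)\circ\Pr_x$. $\mathfrak G$ is the vector space $G=\{\theta(u)|_{\mathcal H}:u\in\mathcal A\}$ with the finest locally convex topology making all maps $h_x:\langle\mathcal L(\mathfrak E_x),\tau_x\rangle\to G$, $h_x(f)=(\imath_x\circ f\circ\Pr_x)|_{\mathcal H}$, continuous. For $T$ locally compact, $\Psi_T^{\mathcal H}:End(\mathcal H)^T\to\prod_xEnd(\mathfrak E_x)^T$, $\Psi_T^{\mathcal H}(\overline F)(x)(s)=\Pr_x\circ\overline F(s)\circ\imath_x$. $\mathsf U$-space. A Hlcs $\mathfrak G'$ is a $\mathsf U$-space with respect to $\{\langle\mathcal L(\mathfrak E_x),\tau_x\rangle\}_{x}$, $\mathfrak T$ and $D$ if $\mathfrak G'\subset\mathcal L(\langle\mathcal H,\mathfrak T\rangle)$ as vector spaces, $D\subseteq\mathcal H$, and for every locally compact space $T$ there is a linear map $\Psi_T:End(\mathcal H)^T\to\prod_xEnd(\mathfrak E_x)^T$ such that for every Radon measure $\nu$ on $T$: $\Psi_T(\mathfrak L_1(T,\mathfrak G',\nu))\subseteq\prod_x\mathfrak L_1(T,\langle\mathcal L(\mathfrak E_x),\tau_x\rangle,\nu)$ and $\bigl(\int\Psi_T(\overline F)(x)(s)\,d\nu(s)\bigr)(v(x))=\bigl((\int\overline F(s)\,d\nu(s))(v)\bigr)(x)$ for all $\overline F\in\mathfrak L_1(T,\mathfrak G',\nu)$, $v\in D$, $x\in X$. *)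

theory Defs
  imports "HOL-Analysis.Analysis" "HOL-Library.Function_Algebras"
begin

text \<open>
  All vector spaces are complex. A vector space is a subspace \<open>V\<close> of an ambient type that is a
  vector space under some \<open>sc\<close>; a family of vector spaces can always be realised as a family of
  subspaces of one ambient space, for instance of its direct sum. Maps with domain \<open>V\<close> are total
  functions that vanish outside \<open>V\<close>, so that equality of maps is equality of functions and spaces
  of maps are again subspaces of an ambient type, with pointwise operations.
\<close>

definition fscale :: "(complex \<Rightarrow> 'v \<Rightarrow> 'v) \<Rightarrow> complex \<Rightarrow> ('i \<Rightarrow> 'v) \<Rightarrow> 'i \<Rightarrow> 'v"
  where "fscale sc c f = (\<lambda>i. sc c (f i))"

lemma vector_space_fscale:
  assumes "vector_space sc"
  shows "vector_space (fscale sc)"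
proof -
  interpret vector_space sc by fact
  show ?thesis
    by unfold_locales (auto simp: fscale_def fun_eq_iff scale_right_distrib scale_left_distrib)
qed

definition cprod :: "'i set \<Rightarrow> ('i \<Rightarrow> 'v::zero set) \<Rightarrow> ('i \<Rightarrow> 'v) set"
  where "cprod I V = {f. (\<forall>i\<in>I. f i \<in> V i) \<and> (\<forall>i. i \<notin> I \<longrightarrow> f i = 0)}"

abbreviation cpower :: "'v::zero set \<Rightarrow> 'i set \<Rightarrow> ('i \<Rightarrow> 'v) set"
  where "cpower V I \<equiv> cprod I (\<lambda>_. V)"

definition rest :: "'a set \<Rightarrow> ('a \<Rightarrow> 'v::zero) \<Rightarrow> 'a \<Rightarrow> 'v"
  where "rest V f = (\<lambda>v. if v \<in> V then f v else 0)"

definition Pr :: "'i \<Rightarrow> ('i \<Rightarrow> 'v) \<Rightarrow> 'v"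
  where "Pr x v = v x"

definition inj_at :: "'i \<Rightarrow> 'v::zero \<Rightarrow> 'i \<Rightarrow> 'v"
  where "inj_at x e = (\<lambda>y. if y = x then e else 0)"

definition lin_maps ::
  "(complex \<Rightarrow> 'v::ab_group_add \<Rightarrow> 'v) \<Rightarrow> 'v set \<Rightarrow> (complex \<Rightarrow> 'w::ab_group_add \<Rightarrow> 'w) \<Rightarrow> 'w set
    \<Rightarrow> ('v \<Rightarrow> 'w) set"
  where "lin_maps sc V sc' W =
    {f \<in> cpower W V. (\<forall>u\<in>V. \<forall>v\<in>V. f (u + v) = f u + f v) \<and>
                     (\<forall>c. \<forall>v\<in>V. f (sc c v) = sc' c (f v))}"

definition End :: "(complex \<Rightarrow> 'v::ab_group_add \<Rightarrow> 'v) \<Rightarrow> 'v set \<Rightarrow> ('v \<Rightarrow> 'v) set"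
  where "End sc V = lin_maps sc V sc V"

definition cont_end ::
  "(complex \<Rightarrow> 'v::ab_group_add \<Rightarrow> 'v) \<Rightarrow> 'v set \<Rightarrow> 'v topology \<Rightarrow> ('v \<Rightarrow> 'v) set"
  where "cont_end sc V \<tau> = {f \<in> End sc V. continuous_map \<tau> \<tau> f}"

definition dual ::
  "(complex \<Rightarrow> 'v::ab_group_add \<Rightarrow> 'v) \<Rightarrow> 'v set \<Rightarrow> 'v topology \<Rightarrow> ('v \<Rightarrow> complex) set"
  where "dual sc V \<tau> = {\<phi> \<in> lin_maps sc V (*) UNIV. continuous_map \<tau> euclidean \<phi>}"


subsection \<open>Locally convex spaces\<close>

definition convex_set :: "(complex \<Rightarrow> 'v::ab_group_add \<Rightarrow> 'v) \<Rightarrow> 'v set \<Rightarrow> bool"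
  where "convex_set sc W \<longleftrightarrow>
    (\<forall>u\<in>W. \<forall>v\<in>W. \<forall>t::real. 0 \<le> t \<and> t \<le> 1 \<longrightarrow>
       sc (complex_of_real (1 - t)) u + sc (complex_of_real t) v \<in> W)"

definition lcs :: "(complex \<Rightarrow> 'v::ab_group_add \<Rightarrow> 'v) \<Rightarrow> 'v set \<Rightarrow> 'v topology \<Rightarrow> bool"
  where "lcs sc V \<tau> \<longleftrightarrow>
    module.subspace sc V \<and> topspace \<tau> = V \<and>
    continuous_map (prod_topology \<tau> \<tau>) \<tau> (\<lambda>(u, v). u + v) \<and>
    continuous_map (prod_topology euclidean \<tau>) \<tau> (\<lambda>(c, v). sc c v) \<and>
    (\<forall>U. openin \<tau> U \<and> 0 \<in> U \<longrightarrow>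
       (\<exists>W N. openin \<tau> N \<and> 0 \<in> N \<and> N \<subseteq> W \<and> W \<subseteq> U \<and> convex_set sc W))"

definition hlcs :: "(complex \<Rightarrow> 'v::ab_group_add \<Rightarrow> 'v) \<Rightarrow> 'v set \<Rightarrow> 'v topology \<Rightarrow> bool"
  where "hlcs sc V \<tau> \<longleftrightarrow> lcs sc V \<tau> \<and> Hausdorff_space \<tau>"

definition seminorm_on :: "(complex \<Rightarrow> 'v::ab_group_add \<Rightarrow> 'v) \<Rightarrow> 'v set \<Rightarrow> ('v \<Rightarrow> real) \<Rightarrow> bool"
  where "seminorm_on sc V p \<longleftrightarrow>
    (\<forall>u\<in>V. \<forall>v\<in>V. p (u + v) \<le> p u + p v) \<and> (\<forall>c. \<forall>v\<in>V. p (sc c v) = cmod c * p v)"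

text \<open>
  The set \<open>Q\<close> defines the topology: finite intersections of balls are a base of neighbourhoods
  of 0. If \<open>Q\<close> is directed this says that the balls themselves form such a base.
\<close>

definition fundamental_seminorms ::
  "(complex \<Rightarrow> 'v::ab_group_add \<Rightarrow> 'v) \<Rightarrow> 'v set \<Rightarrow> 'v topology \<Rightarrow> ('v \<Rightarrow> real) set \<Rightarrow> bool"
  where "fundamental_seminorms sc V \<tau> Q \<longleftrightarrow>
    (\<forall>p\<in>Q. seminorm_on sc V p \<and> continuous_map \<tau> euclideanreal p) \<and>
    (\<forall>U. openin \<tau> U \<and> 0 \<in> U \<longrightarrow>
       (\<exists>P \<epsilon>. finite P \<and> P \<subseteq> Q \<and> 0 < \<epsilon> \<and> {v \<in> V. \<forall>p\<in>P. p v < \<epsilon>} \<subseteq> U))"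

text \<open>
  The supremum of all locally convex (not necessarily Hausdorff) topologies on \<open>V\<close> that make
  every \<open>h x\<close> continuous.
\<close>

definition finest_lc_topology ::
  "(complex \<Rightarrow> 'v::ab_group_add \<Rightarrow> 'v) \<Rightarrow> 'v set \<Rightarrow> 'x set \<Rightarrow> ('x \<Rightarrow> 'w topology) \<Rightarrow>
    ('x \<Rightarrow> 'w \<Rightarrow> 'v) \<Rightarrow> 'v topology"
  where "finest_lc_topology sc V X \<tau> h =
    topology_generated_by
      {U. \<exists>\<sigma>. lcs sc V \<sigma> \<and> (\<forall>x\<in>X. continuous_map (\<tau> x) \<sigma> (h x)) \<and> openin \<sigma> U}"


subsection \<open>Radon measures and essential integration\<close>

text \<open>
  Following Bourbaki, locally compact spaces are Hausdorff and a Radon measure is a linear form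
  on the complex continuous functions with compact support whose restriction to the functions
  supported in any fixed compact set is continuous for the uniform norm.
\<close>

definition loc_compact :: "'t topology \<Rightarrow> bool"
  where "loc_compact T \<longleftrightarrow> locally_compact_space T \<and> Hausdorff_space T"

definition Cc :: "'t topology \<Rightarrow> ('t \<Rightarrow> 'k::real_normed_vector) set"
  where "Cc T = {f. continuous_map T euclidean f \<and> (\<exists>K. compactin T K \<and> (\<forall>t. t \<notin> K \<longrightarrow> f t = 0))}"

definition radon_measure :: "'t topology \<Rightarrow> (('t \<Rightarrow> complex) \<Rightarrow> complex) \<Rightarrow> bool"
  where "radon_measure T \<nu> \<longleftrightarrow>
    \<nu> \<in> lin_maps (fscale (*)) (Cc T) (*) UNIV \<and>
    (\<forall>K. compactin T K \<longrightarrow>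
       (\<exists>M. \<forall>f\<in>Cc T. (\<forall>t. t \<notin> K \<longrightarrow> f t = 0) \<longrightarrow> cmod (\<nu> f) \<le> M * (SUP t. cmod (f t))))"

text \<open>The total variation, on nonnegative continuous functions with compact support.\<close>

definition variation :: "'t topology \<Rightarrow> (('t \<Rightarrow> complex) \<Rightarrow> complex) \<Rightarrow> ('t \<Rightarrow> real) \<Rightarrow> ennreal"
  where "variation T \<nu> f = (SUP g \<in> {g \<in> Cc T. \<forall>t. cmod (g t) \<le> f t}. ennreal (cmod (\<nu> g)))"

definition lower_semicont :: "'t topology \<Rightarrow> ('t \<Rightarrow> ennreal) \<Rightarrow> bool"
  where "lower_semicont T h \<longleftrightarrow> (\<forall>a. openin T {t \<in> topspace T. a < h t})"

definition upper_integral_lsc ::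
  "'t topology \<Rightarrow> (('t \<Rightarrow> complex) \<Rightarrow> complex) \<Rightarrow> ('t \<Rightarrow> ennreal) \<Rightarrow> ennreal"
  where "upper_integral_lsc T \<nu> h =
    (SUP f \<in> {f \<in> Cc T. (\<forall>t. 0 \<le> f t) \<and> (\<forall>t\<in>topspace T. ennreal (f t) \<le> h t)}. variation T \<nu> f)"

definition upper_integral ::
  "'t topology \<Rightarrow> (('t \<Rightarrow> complex) \<Rightarrow> complex) \<Rightarrow> ('t \<Rightarrow> ennreal) \<Rightarrow> ennreal"
  where "upper_integral T \<nu> f =
    (INF h \<in> {h. lower_semicont T h \<and> (\<forall>t\<in>topspace T. f t \<le> h t)}. upper_integral_lsc T \<nu> h)"

text \<open>
  Integrable functions are the limits, in the seminorm given by the upper integral, of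
  continuous functions with compact support; the integral is the extension of \<open>\<nu>\<close> by continuity.
\<close>

definition has_radon_integral ::
  "'t topology \<Rightarrow> (('t \<Rightarrow> complex) \<Rightarrow> complex) \<Rightarrow> ('t \<Rightarrow> complex) \<Rightarrow> complex \<Rightarrow> bool"
  where "has_radon_integral T \<nu> f I \<longleftrightarrow>
    (\<exists>g :: nat \<Rightarrow> 't \<Rightarrow> complex. (\<forall>n. g n \<in> Cc T) \<and>
       (\<lambda>n. upper_integral T \<nu> (\<lambda>t. ennreal (cmod (f t - g n t)))) \<longlonglongrightarrow> 0 \<and>
       (\<lambda>n. \<nu> (g n)) \<longlonglongrightarrow> I)"

definition locally_negligible ::
  "'t topology \<Rightarrow> (('t \<Rightarrow> complex) \<Rightarrow> complex) \<Rightarrow> 't set \<Rightarrow> bool"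
  where "locally_negligible T \<nu> N \<longleftrightarrow>
    (\<forall>K. compactin T K \<longrightarrow> upper_integral T \<nu> (indicator (N \<inter> K)) = 0)"

definition has_ess_integral ::
  "'t topology \<Rightarrow> (('t \<Rightarrow> complex) \<Rightarrow> complex) \<Rightarrow> ('t \<Rightarrow> complex) \<Rightarrow> complex \<Rightarrow> bool"
  where "has_ess_integral T \<nu> f I \<longleftrightarrow>
    (\<exists>g. has_radon_integral T \<nu> g I \<and> locally_negligible T \<nu> {t \<in> topspace T. f t \<noteq> g t})"

definition ess_integrable ::
  "'t topology \<Rightarrow> (('t \<Rightarrow> complex) \<Rightarrow> complex) \<Rightarrow> ('t \<Rightarrow> complex) \<Rightarrow> bool"
  where "ess_integrable T \<nu> f \<longleftrightarrow> (\<exists>I. has_ess_integral T \<nu> f I)"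

definition ess_integral ::
  "'t topology \<Rightarrow> (('t \<Rightarrow> complex) \<Rightarrow> complex) \<Rightarrow> ('t \<Rightarrow> complex) \<Rightarrow> complex"
  where "ess_integral T \<nu> f = (THE I. has_ess_integral T \<nu> f I)"

definition is_weak_integral ::
  "'t topology \<Rightarrow> (complex \<Rightarrow> 'v::ab_group_add \<Rightarrow> 'v) \<Rightarrow> 'v set \<Rightarrow> 'v topology \<Rightarrow>
    (('t \<Rightarrow> complex) \<Rightarrow> complex) \<Rightarrow> ('t \<Rightarrow> 'v) \<Rightarrow> 'v \<Rightarrow> bool"
  where "is_weak_integral T sc V \<tau> \<nu> F I \<longleftrightarrow>
    I \<in> V \<and> (\<forall>\<phi>\<in>dual sc V \<tau>. \<phi> I = ess_integral T \<nu> (\<lambda>s. \<phi> (F s)))"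

definition L1 ::
  "'t topology \<Rightarrow> (complex \<Rightarrow> 'v::ab_group_add \<Rightarrow> 'v) \<Rightarrow> 'v set \<Rightarrow> 'v topology \<Rightarrow>
    (('t \<Rightarrow> complex) \<Rightarrow> complex) \<Rightarrow> ('t \<Rightarrow> 'v) set"
  where "L1 T sc V \<tau> \<nu> =
    {F \<in> cpower V (topspace T).
       (\<forall>\<phi>\<in>dual sc V \<tau>. ess_integrable T \<nu> (\<lambda>s. \<phi> (F s))) \<and> (\<exists>I. is_weak_integral T sc V \<tau> \<nu> F I)}"

definition weak_integral ::
  "'t topology \<Rightarrow> (complex \<Rightarrow> 'v::ab_group_add \<Rightarrow> 'v) \<Rightarrow> 'v set \<Rightarrow> 'v topology \<Rightarrow>
    (('t \<Rightarrow> complex) \<Rightarrow> complex) \<Rightarrow> ('t \<Rightarrow> 'v) \<Rightarrow> 'v"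
  where "weak_integral T sc V \<tau> \<nu> F = (THE I. is_weak_integral T sc V \<tau> \<nu> F I)"


subsection \<open>Consistent classes of data and U-spaces\<close>

definition theta ::
  "'x set \<Rightarrow> ('x \<Rightarrow> 'e::ab_group_add set) \<Rightarrow> ('x \<Rightarrow> 'e \<Rightarrow> 'e) \<Rightarrow> ('x \<Rightarrow> 'e) \<Rightarrow> 'x \<Rightarrow> 'e"
  where "theta X E u = rest (cprod X E) (\<lambda>v x. Pr x u (Pr x v))"

locale consistent_data =
  fixes sc :: "complex \<Rightarrow> 'e::ab_group_add \<Rightarrow> 'e"
    and X :: "'x set"
    and Y :: "'y topology"
    and \<mu> :: "('y \<Rightarrow> complex) \<Rightarrow> complex"
    and E :: "'x \<Rightarrow> 'e set"
    and tE :: "'x \<Rightarrow> 'e topology"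
    and QE :: "'x \<Rightarrow> ('e \<Rightarrow> real) set"
    and \<tau> :: "'x \<Rightarrow> ('e \<Rightarrow> 'e) topology"
    and Q\<tau> :: "'x \<Rightarrow> (('e \<Rightarrow> 'e) \<Rightarrow> real) set"
    and H :: "('x \<Rightarrow> 'e) set"
    and tH :: "('x \<Rightarrow> 'e) topology"
    and A :: "('x \<Rightarrow> 'e \<Rightarrow> 'e) set"
  assumes vs: "vector_space sc"
    and Y: "loc_compact Y"
    and \<mu>: "radon_measure Y \<mu>"
    and E: "x \<in> X \<Longrightarrow> hlcs sc (E x) (tE x)"
    and QE: "x \<in> X \<Longrightarrow> fundamental_seminorms sc (E x) (tE x) (QE x)"
    and \<tau>: "x \<in> X \<Longrightarrow> hlcs (fscale sc) (cont_end sc (E x) (tE x)) (\<tau> x)"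
    and Q\<tau>: "x \<in> X \<Longrightarrow>
      fundamental_seminorms (fscale sc) (cont_end sc (E x) (tE x)) (\<tau> x) (Q\<tau> x)"
    and H: "hlcs (fscale sc) H tH"
    and H_subset: "H \<subseteq> cprod X E"
    and inj_H: "x \<in> X \<Longrightarrow> inj_at x ` E x \<subseteq> H"
    and Pr_cont: "x \<in> X \<Longrightarrow> continuous_map tH (tE x) (Pr x)"
    and inj_cont: "x \<in> X \<Longrightarrow> continuous_map (tE x) tH (inj_at x)"
    and A: "module.subspace (fscale (fscale sc)) A"
    and A_subset: "A \<subseteq> cprod X (\<lambda>x. cont_end sc (E x) (tE x))"
    and theta_A: "u \<in> A \<Longrightarrow> rest H (theta X E u) \<in> cont_end (fscale sc) H tH"
    and inj_A: "x \<in> X \<Longrightarrow> inj_at x ` cont_end sc (E x) (tE x) \<subseteq> A"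

definition G_space ::
  "'x set \<Rightarrow> ('x \<Rightarrow> 'e::ab_group_add set) \<Rightarrow> ('x \<Rightarrow> 'e) set \<Rightarrow> ('x \<Rightarrow> 'e \<Rightarrow> 'e) set \<Rightarrow>
    (('x \<Rightarrow> 'e) \<Rightarrow> 'x \<Rightarrow> 'e) set"
  where "G_space X E H A = {rest H (theta X E u) | u. u \<in> A}"

definition h_map ::
  "('x \<Rightarrow> 'e::ab_group_add) set \<Rightarrow> 'x \<Rightarrow> ('e \<Rightarrow> 'e) \<Rightarrow> ('x \<Rightarrow> 'e) \<Rightarrow> 'x \<Rightarrow> 'e"
  where "h_map H x f = rest H (inj_at x \<circ> f \<circ> Pr x)"

definition G_top ::
  "(complex \<Rightarrow> 'e::ab_group_add \<Rightarrow> 'e) \<Rightarrow> 'x set \<Rightarrow> ('x \<Rightarrow> 'e set) \<Rightarrow> ('x \<Rightarrow> ('e \<Rightarrow> 'e) topology) \<Rightarrow>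
    ('x \<Rightarrow> 'e) set \<Rightarrow> ('x \<Rightarrow> 'e \<Rightarrow> 'e) set \<Rightarrow> (('x \<Rightarrow> 'e) \<Rightarrow> 'x \<Rightarrow> 'e) topology"
  where "G_top sc X E \<tau> H A =
    finest_lc_topology (fscale (fscale sc)) (G_space X E H A) X \<tau> (h_map H)"

definition Psi ::
  "'x set \<Rightarrow> ('x \<Rightarrow> 'e::ab_group_add set) \<Rightarrow> 't topology \<Rightarrow> ('t \<Rightarrow> ('x \<Rightarrow> 'e) \<Rightarrow> 'x \<Rightarrow> 'e) \<Rightarrow>
    'x \<Rightarrow> 't \<Rightarrow> 'e \<Rightarrow> 'e"
  where "Psi X E T F =
    rest X (\<lambda>x. rest (topspace T) (\<lambda>s. rest (E x) (Pr x \<circ> F s \<circ> inj_at x)))"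

text \<open>
  The type argument is the type of the points of the locally compact spaces \<open>T\<close>: quantification
  over all locally compact spaces is quantification over this type and over \<open>T\<close>.
\<close>

definition U_space ::
  "'t itself \<Rightarrow> (complex \<Rightarrow> 'e::ab_group_add \<Rightarrow> 'e) \<Rightarrow> 'x set \<Rightarrow> ('x \<Rightarrow> 'e set) \<Rightarrow>
    ('x \<Rightarrow> 'e topology) \<Rightarrow> ('x \<Rightarrow> ('e \<Rightarrow> 'e) topology) \<Rightarrow> ('x \<Rightarrow> 'e) set \<Rightarrow> ('x \<Rightarrow> 'e) topology \<Rightarrow>
    ('x \<Rightarrow> 'e) set \<Rightarrow> (('x \<Rightarrow> 'e) \<Rightarrow> 'x \<Rightarrow> 'e) set \<Rightarrow> (('x \<Rightarrow> 'e) \<Rightarrow> 'x \<Rightarrow> 'e) topology \<Rightarrow> bool"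
  where "U_space (_ :: 't itself) sc X E tE \<tau> H tH D G tG \<longleftrightarrow>
    hlcs (fscale (fscale sc)) G tG \<and> G \<subseteq> cont_end (fscale sc) H tH \<and> D \<subseteq> H \<and>
    (\<forall>T :: 't topology. loc_compact T \<longrightarrow>
      (\<exists>\<Psi> \<in> lin_maps
              (fscale (fscale (fscale sc))) (cpower (End (fscale sc) H) (topspace T))
              (fscale (fscale (fscale sc))) (cprod X (\<lambda>x. cpower (End sc (E x)) (topspace T))).
        \<forall>\<nu>. radon_measure T \<nu> \<longrightarrow>
          \<Psi> ` L1 T (fscale (fscale sc)) G tG \<nu>
            \<subseteq> cprod X (\<lambda>x. L1 T (fscale sc) (cont_end sc (E x) (tE x)) (\<tau> x) \<nu>) \<and>
          (\<forall>F \<in> L1 T (fscale (fscale sc)) G tG \<nu>. \<forall>v\<in>D. \<forall>x\<in>X.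
            weak_integral T (fscale sc) (cont_end sc (E x) (tE x)) (\<tau> x) \<nu> (\<Psi> F x) (v x) =
            weak_integral T (fscale (fscale sc)) G tG \<nu> F v x)))"

end

theory Submission
  imports Defs
begin

text \<open>
  The map \<open>component x\<close>, \<open>g \<mapsto> Pr\<^sub>x \<circ> g \<circ> \<iota>\<^sub>x\<close>, sends \<open>\<theta>(u)|H\<close> to \<open>u x\<close> and is continuous from \<open>G\<close> to
  \<open>\<L>(E\<^sub>x)\<close>, because its composite with each \<open>h\<^sub>y\<close> is the identity or zero. Weak integrals commute
  with continuous linear maps, so \<open>component x\<close> of the integral \<open>\<theta>(u)|H\<close> of \<open>F\<close> is a weak integral of
  \<open>Psi F x = component x \<circ> F\<close>, and evaluating \<open>u x\<close> at \<open>v x\<close> gives \<open>(\<theta>(u) v) x\<close>. The weak integrals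
  are unique because the duals separate points: for \<open>\<L>(E\<^sub>x)\<close> by the Hahn-Banach theorem, and for \<open>G\<close>
  because the maps \<open>component x\<close> are jointly injective, which also makes \<open>G\<close> Hausdorff.
\<close>

section \<open>The Hahn-Banach theorem\<close>

locale complex_subspace = vector_space sc
  for sc :: "complex \<Rightarrow> 'v::ab_group_add \<Rightarrow> 'v" +
  fixes V :: "'v set"
  assumes subspace: "subspace V"
begin

section \<open>Sublinear functionals\<close>

definition sublinear :: "('v \<Rightarrow> real) \<Rightarrow> bool"
  where "sublinear q \<longleftrightarrow>
    (\<forall>u\<in>V. \<forall>v\<in>V. q (u + v) \<le> q u + q v) \<and>
    (\<forall>t\<ge>0. \<forall>v\<in>V. q (sc (complex_of_real t) v) = t * q v)"

lemma closed [simp]: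
  "0 \<in> V" "u \<in> V \<Longrightarrow> v \<in> V \<Longrightarrow> u + v \<in> V" "v \<in> V \<Longrightarrow> sc c v \<in> V" "v \<in> V \<Longrightarrow> - v \<in> V"
  "u \<in> V \<Longrightarrow> v \<in> V \<Longrightarrow> u - v \<in> V"
  using subspace by (auto intro: subspace_0 subspace_add subspace_scale subspace_neg subspace_diff)

lemma sublinearD:
  assumes "sublinear q"
  shows "u \<in> V \<Longrightarrow> v \<in> V \<Longrightarrow> q (u + v) \<le> q u + q v"
    and "0 \<le> t \<Longrightarrow> v \<in> V \<Longrightarrow> q (sc (complex_of_real t) v) = t * q v"
  using assms by (auto simp: sublinear_def)

lemma sublinear_0: "sublinear q \<Longrightarrow> q 0 = 0"
  using sublinearD(2)[of q 0 0] by simp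

lemma sublinear_neg: "sublinear q \<Longrightarrow> v \<in> V \<Longrightarrow> - q (- v) \<le> q v"
  using sublinearD(1)[of q v "- v"] sublinear_0[of q] by simp

text \<open>One inequality for positive \<open>t\<close> suffices: applying it with
  \<open>1 / t\<close> to the vector \<open>sc t v\<close> gives the reverse inequality.\<close>

lemma sublinearI:
  assumes add: "\<And>u v. u \<in> V \<Longrightarrow> v \<in> V \<Longrightarrow> q (u + v) \<le> q u + q v"
    and zero: "q 0 = 0"
    and scale: "\<And>t v. 0 < t \<Longrightarrow> v \<in> V \<Longrightarrow> q (sc (complex_of_real t) v) \<le> t * q v"
  shows "sublinear q"
proof -
  have "q (sc (complex_of_real t) v) = t * q v" if t: "0 \<le> t" and v: "v \<in> V" for t v
  proof (cases "t = 0")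
    case False
    with t have t: "0 < t" by simp
    have "q (sc (complex_of_real (1 / t)) (sc (complex_of_real t) v))
        \<le> (1 / t) * q (sc (complex_of_real t) v)"
      by (rule scale) (use t v in auto)
    moreover have "complex_of_real (1 / t) * complex_of_real t = 1"
      using t by (simp flip: of_real_mult)
    ultimately have "q v \<le> (1 / t) * q (sc (complex_of_real t) v)"
      by (simp add: scale_scale)
    then have "t * q v \<le> q (sc (complex_of_real t) v)"
      using t by (simp add: field_simps)
    with scale[OF t v] show ?thesis by simp
  qed (simp add: zero)
  with add show ?thesis by (simp add: sublinear_def)
qed

text \<open>The functional is \<open>r v = inf {q (v + t w) - t * q w | t \<ge> 0}\<close>. Taking
  \<open>t = 0\<close> bounds it by \<open>q\<close>, and \<open>t = 1\<close> at \<open>- w\<close>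
  gives \<open>- q w\<close>. A minimal sublinear functional must coincide with its own tilts, which
  forces it to be linear.\<close>

lemma sublinear_tilt:
  assumes q: "sublinear q" and w: "w \<in> V"
  obtains r where "sublinear r" "\<And>v. v \<in> V \<Longrightarrow> r v \<le> q v" "\<And>v. v \<notin> V \<Longrightarrow> r v = 0"
    "r (- w) \<le> - q w"
proof -
  define g where "g v t = q (v + sc (complex_of_real t) w) - t * q w" for v t
  define r where "r v = (if v \<in> V then INF t\<in>{0..}. g v t else 0)" for v
  \<comment> \<open>The infimum is finite: \<open>t * q w\<close> is the value of \<open>q\<close>
    at \<open>t w = (v + t w) + (- v)\<close>, so subadditivity bounds \<open>g v t\<close> below
    independently of \<open>t\<close>.\<close>
  have lower: "- q (- v) \<le> g v t" if "v \<in> V" "0 \<le> t" for v t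
  proof -
    have "t * q w = q ((v + sc (complex_of_real t) w) + - v)"
      using that w by (simp add: sublinearD(2)[OF q])
    also have "\<dots> \<le> q (v + sc (complex_of_real t) w) + q (- v)"
      by (rule sublinearD(1)[OF q]) (use that w in auto)
    finally show ?thesis by (simp add: g_def)
  qed
  have bdd: "bdd_below (g v ` {0..})" if "v \<in> V" for v
    using lower[OF that] by (auto intro!: bdd_belowI)
  have le: "r v \<le> g v t" if "v \<in> V" "0 \<le> t" for v t
    using that bdd by (auto simp: r_def intro!: cINF_lower)
  have ge: "c \<le> r v" if "v \<in> V" "\<And>t. 0 \<le> t \<Longrightarrow> c \<le> g v t" for v c
    using that by (auto simp: r_def intro!: cINF_greatest)
  have r_le: "r v \<le> q v" if "v \<in> V" for v
    using le[OF that, of 0] by (simp add: g_def)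
  have sub: "sublinear r"
  proof (rule sublinearI)
    fix u v assume u: "u \<in> V" and v: "v \<in> V"
    \<comment> \<open>The parameters add up: the value of \<open>g (u + v)\<close> at
      \<open>s + t\<close> is controlled by those of \<open>g u\<close> at \<open>s\<close> and
      \<open>g v\<close> at \<open>t\<close>. The infimum is then taken over \<open>s\<close> first
      and over \<open>t\<close> second.\<close>
    have *: "r (u + v) \<le> g u s + g v t" if "0 \<le> s" "0 \<le> t" for s t
    proof -
      have "r (u + v) \<le> g (u + v) (s + t)"
        using u v that by (intro le) auto
      also have "\<dots> = q ((u + sc (complex_of_real s) w) + (v + sc (complex_of_real t) w)) - (s + t) * q w"
        by (simp add: g_def scale_left_distrib algebra_simps)
      also have "\<dots> \<le> g u s + g v t"
        using sublinearD(1)[OF q, of "u + sc (complex_of_real s) w" "v + sc (complex_of_real t) w"] u v w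
        by (simp add: g_def algebra_simps)
      finally show ?thesis .
    qed
    have "r (u + v) - g v t \<le> r u" if "0 \<le> t" for t
      using * that by (intro ge u) (simp add: algebra_simps)
    then have "r (u + v) - r u \<le> r v"
      by (intro ge v) (simp add: algebra_simps)
    then show "r (u + v) \<le> r u + r v" by simp
  next
    show "r 0 = 0"
      using r_le[of 0] ge[of 0 0] lower[of 0] by (simp add: sublinear_0[OF q])
  next
    fix t v assume t: "(0::real) < t" and v: "v \<in> V"
    have "r (sc (complex_of_real t) v) / t \<le> r v"
    proof (rule ge[OF v])
      fix s :: real assume s: "0 \<le> s"
      have "r (sc (complex_of_real t) v) \<le> g (sc (complex_of_real t) v) (t * s)"
        using s t v by (intro le) auto
      also have "\<dots> = q (sc (complex_of_real t) (v + sc (complex_of_real s) w)) - t * s * q w"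
        by (simp add: g_def scale_right_distrib)
      also have "\<dots> = t * g v s"
        using t v w sublinearD(2)[OF q, of t "v + sc (complex_of_real s) w"]
        by (simp add: g_def right_diff_distrib del: scale_scale)
      finally show "r (sc (complex_of_real t) v) / t \<le> g v s"
        using t by (simp add: field_simps)
    qed
    then show "r (sc (complex_of_real t) v) \<le> t * r v"
      using t by (simp add: field_simps)
  qed
  have "r (- w) \<le> g (- w) 1"
    using w by (intro le) auto
  then have "r (- w) \<le> - q w"
    by (simp add: g_def sublinear_0[OF q])
  moreover have "r v = 0" if "v \<notin> V" for v
    using that by (simp add: r_def)
  ultimately show thesis
    using sub r_le by (intro that)
qed

text \<open>Zorn's lemma for the reversed pointwise order, with pointwise infima as bounds of
  chains. The value 0 outside \<open>V\<close> turns comparison on \<open>V\<close> into comparison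
  of total functions, so that minimality yields an equality of functions.\<close>

lemma minimal_sublinear_exists:
  assumes p: "sublinear p" and p0: "\<And>v. v \<notin> V \<Longrightarrow> p v = 0"
  obtains q where "sublinear q" "\<And>v. v \<in> V \<Longrightarrow> q v \<le> p v"
    "\<And>r. sublinear r \<Longrightarrow> (\<And>v. v \<in> V \<Longrightarrow> r v \<le> q v) \<Longrightarrow> (\<And>v. v \<notin> V \<Longrightarrow> r v = 0) \<Longrightarrow> r = q"
proof -
  define S where "S = {q. sublinear q \<and> q \<le> p \<and> (\<forall>v. v \<notin> V \<longrightarrow> q v = 0)}"
  have "\<exists>m\<in>S. \<forall>a\<in>S. m \<ge> a \<longrightarrow> a = m"
  proof (rule predicate_Zorn)
    show "partial_order_on S (relation_of (\<ge>) S)"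
      by (rule partial_order_on_relation_ofI) auto
    fix C assume C: "C \<in> Chains (relation_of (\<ge>) S)"
    have CS: "C \<subseteq> S" and chain: "\<And>a b. a \<in> C \<Longrightarrow> b \<in> C \<Longrightarrow> a \<le> b \<or> b \<le> a"
      using C by (auto simp: Chains_def relation_of_def)
    show "\<exists>u\<in>S. \<forall>a\<in>C. a \<ge> u"
    proof (cases "C = {}")
      case True
      have "p \<in> S" using p p0 by (simp add: S_def)
      with True show ?thesis by blast
    next
      case False
      define r where "r v = (if v \<in> V then INF q\<in>C. q v else 0)" for v
      have Csub: "sublinear q" "q \<le> p" "\<And>v. v \<notin> V \<Longrightarrow> q v = 0" if "q \<in> C" for q
        using that CS by (auto simp: S_def)
      \<comment> \<open>All members of the chain lie below \<open>p\<close>, so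
        \<open>q v \<ge> - q (- v) \<ge> - p (- v)\<close> is a bound independent of
        \<open>q\<close>.\<close>
      have bdd: "bdd_below ((\<lambda>q. q v) ` C)" if v: "v \<in> V" for v
      proof (rule bdd_belowI2)
        fix q assume "q \<in> C"
        then show "- p (- v) \<le> q v"
          using sublinear_neg[OF Csub(1) v] le_funD[OF Csub(2), of q "- v"] by force
      qed
      have le: "r v \<le> q v" if "q \<in> C" "v \<in> V" for q v
        using that bdd by (auto simp: r_def intro!: cINF_lower)
      have ge: "c \<le> r v" if "v \<in> V" "\<And>q. q \<in> C \<Longrightarrow> c \<le> q v" for v c
        using that False by (auto simp: r_def intro!: cINF_greatest)
      have "sublinear r"
      proof (rule sublinearI)
        fix u v assume u: "u \<in> V" and v: "v \<in> V"
        \<comment> \<open>The smaller one of \<open>a\<close> and \<open>b\<close> is sublinear and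
          lies below both, which handles two different members of the chain at once.\<close>
        have *: "r (u + v) \<le> a u + b v" if a: "a \<in> C" and b: "b \<in> C" for a b
        proof -
          obtain c where c: "c \<in> C" "c \<le> a" "c \<le> b"
            using chain[OF a b] a b by blast
          have "r (u + v) \<le> c u + c v"
            using le[OF c(1), of "u + v"] sublinearD(1)[OF Csub(1)[OF c(1)] u v] u v by simp
          also have "\<dots> \<le> a u + b v"
            using le_funD[OF c(2), of u] le_funD[OF c(3), of v] by simp
          finally show ?thesis .
        qed
        have "r (u + v) - b v \<le> r u" if "b \<in> C" for b
          using * that by (intro ge u) (simp add: algebra_simps)
        then have "r (u + v) - r u \<le> r v"
          by (intro ge v) (simp add: algebra_simps)
        then show "r (u + v) \<le> r u + r v" by simp
      next
        show "r 0 = 0"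
          using False by (simp add: r_def sublinear_0[OF Csub(1)])
      next
        fix t v assume t: "(0::real) < t" and v: "v \<in> V"
        have "r (sc (complex_of_real t) v) / t \<le> r v"
        proof (rule ge[OF v])
          fix q assume q: "q \<in> C"
          have "r (sc (complex_of_real t) v) \<le> t * q v"
            using le[OF q, of "sc (complex_of_real t) v"] sublinearD(2)[OF Csub(1)[OF q], of t v] v t
            by simp
          then show "r (sc (complex_of_real t) v) / t \<le> q v"
            using t by (simp add: field_simps)
        qed
        then show "r (sc (complex_of_real t) v) \<le> t * r v"
          using t by (simp add: field_simps)
      qed
      moreover have r_le: "r \<le> a" if a: "a \<in> C" for a
      proof (rule le_funI)
        fix v show "r v \<le> a v"
          using le[OF a, of v] Csub(3)[OF a, of v] by (cases "v \<in> V") (simp_all add: r_def)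
      qed
      moreover have "r \<le> p"
      proof -
        obtain a where a: "a \<in> C" using False by blast
        show ?thesis
          using r_le[OF a] Csub(2)[OF a] by (rule order_trans)
      qed
      moreover have "r v = 0" if "v \<notin> V" for v
        using that by (simp add: r_def)
      ultimately have "r \<in> S"
        by (simp add: S_def)
      with r_le show ?thesis by blast
    qed
  qed
  then obtain m where "m \<in> S" and "\<forall>a\<in>S. a \<le> m \<longrightarrow> a = m" ..
  then have m: "m \<in> S" "\<And>a. a \<in> S \<Longrightarrow> a \<le> m \<Longrightarrow> a = m"
    by simp_all
  show thesis
  proof (rule that)
    show "sublinear m" "\<And>v. m v \<le> p v"
      using m(1) by (auto simp: S_def le_fun_def)
    fix r assume r: "sublinear r" "\<And>v. v \<in> V \<Longrightarrow> r v \<le> m v" "\<And>v. v \<notin> V \<Longrightarrow> r v = 0"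
    have "r v \<le> m v" for v
      using r(2,3)[of v] m(1) by (cases "v \<in> V") (simp_all add: S_def)
    then have "r \<le> m" by (rule le_funI)
    moreover have "m \<le> p" using m(1) by (simp add: S_def)
    ultimately have "r \<le> p" by (rule order_trans)
    with r have "r \<in> S"
      by (simp add: S_def)
    then show "r = m"
      using \<open>r \<le> m\<close> by (rule m(2))
  qed
qed

text \<open>By minimality \<open>q\<close> equals its tilt along any \<open>w\<close>, so
  \<open>q (- w) \<le> - q w\<close>. Hence \<open>q\<close> is odd, and an odd sublinear functional
  is linear: subadditivity at \<open>- u\<close> and \<open>- v\<close> is the reverse
  inequality.\<close>

lemma minimal_sublinear_linear:
  assumes q: "sublinear q"
    and min: "\<And>r. sublinear r \<Longrightarrow> (\<And>v. v \<in> V \<Longrightarrow> r v \<le> q v) \<Longrightarrow> (\<And>v. v \<notin> V \<Longrightarrow> r v = 0) \<Longrightarrow> r = q"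
  shows "u \<in> V \<Longrightarrow> v \<in> V \<Longrightarrow> q (u + v) = q u + q v"
    and "v \<in> V \<Longrightarrow> q (sc (complex_of_real t) v) = t * q v"
proof -
  have odd: "q (- w) = - q w" if w: "w \<in> V" for w
  proof -
    obtain r where r: "sublinear r" "\<And>v. v \<in> V \<Longrightarrow> r v \<le> q v" "\<And>v. v \<notin> V \<Longrightarrow> r v = 0"
        "r (- w) \<le> - q w"
      using sublinear_tilt[OF q w] by blast
    then have "r = q" by (intro min)
    with r(4) sublinear_neg[OF q w] show ?thesis by simp
  qed
  show "q (u + v) = q u + q v" if "u \<in> V" "v \<in> V" for u v
    using sublinearD(1)[OF q, of u v] sublinearD(1)[OF q, of "- u" "- v"] odd[of u] odd[of v]
      odd[of "u + v"] that by (simp add: algebra_simps)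
  show "q (sc (complex_of_real t) v) = t * q v" if v: "v \<in> V"
  proof (cases "0 \<le> t")
    case False
    then have "q (sc (complex_of_real (- t)) v) = - t * q v"
      by (intro sublinearD(2)[OF q]) (use v in auto)
    with odd[of "sc (complex_of_real t) v"] v show ?thesis by simp
  qed (use v q sublinearD(2) in auto)
qed

text \<open>Minimal sublinear functionals are linear, so a functional exposing \<open>w\<close> is obtained by
  tilting \<open>p\<close> along \<open>w\<close> and descending to a minimal sublinear functional; no extension from
  proper subspaces is needed.\<close>

lemma hahn_banach_real:
  assumes p: "sublinear p" and w: "w \<in> V"
  obtains r where "\<And>u v. u \<in> V \<Longrightarrow> v \<in> V \<Longrightarrow> r (u + v) = r u + r v"
    "\<And>t v. v \<in> V \<Longrightarrow> r (sc (complex_of_real t) v) = t * r v"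
    "\<And>v. v \<in> V \<Longrightarrow> r v \<le> p v" "r w = p w"
proof -
  obtain s where s: "sublinear s" "\<And>v. v \<in> V \<Longrightarrow> s v \<le> p v" "\<And>v. v \<notin> V \<Longrightarrow> s v = 0"
      "s (- w) \<le> - p w"
    using sublinear_tilt[OF p w] by blast
  obtain q where q: "sublinear q" "\<And>v. v \<in> V \<Longrightarrow> q v \<le> s v"
    "\<And>r. sublinear r \<Longrightarrow> (\<And>v. v \<in> V \<Longrightarrow> r v \<le> q v) \<Longrightarrow> (\<And>v. v \<notin> V \<Longrightarrow> r v = 0) \<Longrightarrow> r = q"
    using minimal_sublinear_exists[OF s(1,3)] by blast
  have le: "q v \<le> p v" if "v \<in> V" for v
    using q(2)[OF that] s(2)[OF that] by simp
  \<comment> \<open>The chain is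
    \<open>p w \<le> - s (- w) \<le> - q (- w) \<le> q w\<close>.\<close>
  have "p w \<le> q w"
    using q(2)[of "- w"] s(4) sublinear_neg[OF q(1), of w] w by simp
  with le[OF w] have "q w = p w" by simp
  show thesis
  proof (rule that)
    show "q (u + v) = q u + q v" if "u \<in> V" "v \<in> V" for u v
      by (rule minimal_sublinear_linear(1)[OF q(1) _ that]) (rule q(3))
    show "q (sc (complex_of_real t) v) = t * q v" if "v \<in> V" for t v
      by (rule minimal_sublinear_linear(2)[OF q(1) _ that]) (rule q(3))
  qed fact+
qed

section \<open>Complex functionals dominated by a seminorm\<close>

lemma seminorm_nonneg:
  assumes "seminorm_on sc V p" "v \<in> V"
  shows "0 \<le> p v"
proof -
  have scale: "p (sc c v) = cmod c * p v" for c
    using assms by (simp add: seminorm_on_def)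
  have "p (v + - v) \<le> p v + p (- v)"
    using assms closed(4) unfolding seminorm_on_def by blast
  then show ?thesis
    using scale[of 0] scale[of "-1"] by simp
qed

lemma hahn_banach_complex:
  assumes p: "seminorm_on sc V p" and w: "w \<in> V"
  obtains \<phi> where "\<phi> \<in> lin_maps sc V (*) UNIV" "\<And>v. v \<in> V \<Longrightarrow> cmod (\<phi> v) \<le> p v" "Re (\<phi> w) = p w"
proof -
  have "sublinear p"
    using p by (auto simp: sublinear_def seminorm_on_def)
  then obtain r where r: "\<And>u v. u \<in> V \<Longrightarrow> v \<in> V \<Longrightarrow> r (u + v) = r u + r v"
    "\<And>t v. v \<in> V \<Longrightarrow> r (sc (complex_of_real t) v) = t * r v"
    "\<And>v. v \<in> V \<Longrightarrow> r v \<le> p v" "r w = p w"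
    using hahn_banach_real[OF _ w] by blast
  \<comment> \<open>A complex linear form with real part \<open>r\<close> must have imaginary part
    \<open>- r (sc \<i> v)\<close>, because multiplication by \<open>\<i>\<close> exchanges the two
    parts up to sign.\<close>
  define \<phi> where "\<phi> v = (if v \<in> V then Complex (r v) (- r (sc \<i> v)) else 0)" for v
  have scale: "\<phi> (sc c v) = c * \<phi> v" if v: "v \<in> V" for c v
  proof -
    \<comment> \<open>Real linearity determines \<open>r\<close> on all complex multiples of
      \<open>v\<close>; the cases \<open>d = c\<close> and \<open>d = \<i> * c\<close> yield the two
      parts of \<open>\<phi> (sc c v)\<close>.\<close>
    have split: "r (sc d v) = Re d * r v + Im d * r (sc \<i> v)" for d
    proof -
      have "sc d v = sc (complex_of_real (Re d)) v + sc (complex_of_real (Im d)) (sc \<i> v)"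
        by (simp add: scale_scale flip: scale_left_distrib)
          (metis complex_eq mult.commute)
      then show ?thesis using v by (simp add: r del: scale_scale)
    qed
    show ?thesis
      using v split[of c] split[of "\<i> * c"] by (simp add: \<phi>_def complex_eq_iff)
  qed
  have "\<phi> (u + v) = \<phi> u + \<phi> v" if "u \<in> V" "v \<in> V" for u v
    using that by (simp add: \<phi>_def complex_eq_iff r scale_right_distrib)
  moreover have "\<phi> v = 0" if "v \<notin> V" for v
    using that by (simp add: \<phi>_def)
  ultimately have lin: "\<phi> \<in> lin_maps sc V (*) UNIV"
    using scale by (simp add: lin_maps_def cprod_def)
  have "cmod (\<phi> v) \<le> p v" if v: "v \<in> V" for v
  proof (cases "\<phi> v = 0")
    case True
    then show ?thesis using seminorm_nonneg[OF p v] by simp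
  next
    case False
    \<comment> \<open>A unit scalar rotating \<open>\<phi> v\<close> onto the positive real axis: at
      \<open>sc c v\<close> the form equals its real part \<open>r\<close>, where the bound by
      \<open>p\<close> is known, and \<open>p\<close> does not change under the rotation.\<close>
    define c where "c = cnj (sgn (\<phi> v))"
    have "c * \<phi> v = complex_of_real ((cmod (\<phi> v))\<^sup>2 / cmod (\<phi> v))"
      by (simp add: c_def sgn_eq complex_norm_square mult.commute del: of_real_power)
    then have c: "cmod c = 1" "c * \<phi> v = complex_of_real (cmod (\<phi> v))"
      using False by (simp_all add: c_def norm_sgn power2_eq_square)
    have "cmod (\<phi> v) = Re (\<phi> (sc c v))"
      using v c by (simp add: scale)
    also have "\<dots> \<le> p (sc c v)"
      using v r(3) by (simp add: \<phi>_def)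
    also have "\<dots> = p v"
      using p v c by (simp add: seminorm_on_def)
    finally show ?thesis .
  qed
  moreover have "Re (\<phi> w) = p w"
    using w r(4) by (simp add: \<phi>_def)
  ultimately show thesis
    using lin that by blast
qed

end

text \<open>By linearity \<open>cmod (\<phi> w - \<phi> v) \<le> p (w - v)\<close>, and the
  right-hand side is continuous in \<open>w\<close> and vanishes at \<open>v\<close>.\<close>

lemma (in complex_subspace) dominated_linear_in_dual:
  assumes lcs: "lcs sc V \<tau>" and \<phi>: "\<phi> \<in> lin_maps sc V (*) UNIV"
    and p: "continuous_map \<tau> euclideanreal p" and le: "\<And>v. v \<in> V \<Longrightarrow> cmod (\<phi> v) \<le> p v" and p0: "p 0 = 0"
  shows "\<phi> \<in> dual sc V \<tau>"
proof -
  have top: "topspace \<tau> = V"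
    and add: "continuous_map (prod_topology \<tau> \<tau>) \<tau> (\<lambda>(u, v). u + v)"
    using lcs by (auto simp: lcs_def)
  have \<phi>_add: "\<phi> (u + v) = \<phi> u + \<phi> v" if "u \<in> V" "v \<in> V" for u v
    using \<phi> that by (simp add: lin_maps_def)
  have "openin \<tau> {v \<in> topspace \<tau>. \<phi> v \<in> U}" if U: "open U" for U
  proof (subst openin_subopen, intro ballI)
    fix v assume "v \<in> {v \<in> topspace \<tau>. \<phi> v \<in> U}"
    then have v: "v \<in> V" "\<phi> v \<in> U" by (auto simp: top)
    from U v(2) obtain e where e: "0 < e" "ball (\<phi> v) e \<subseteq> U"
      by (meson openE)
    \<comment> \<open>Translation by \<open>- v\<close> is addition restricted to a slice of the
      product, hence continuous.\<close>
    have "continuous_map \<tau> \<tau> ((\<lambda>(u, v). u + v) \<circ> (\<lambda>w. (w, - v)))"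
      using v(1) by (intro continuous_map_compose[OF _ add]) (simp add: continuous_map_pairedI top)
    then have "continuous_map \<tau> euclideanreal (p \<circ> (\<lambda>w. w - v))"
      by (intro continuous_map_compose[OF _ p]) (simp add: o_def)
    then have "openin \<tau> {w \<in> topspace \<tau>. (p \<circ> (\<lambda>w. w - v)) w \<in> {..<e}}"
      by (rule openin_continuous_map_preimage) (simp flip: open_openin)
    moreover have "v \<in> {w \<in> topspace \<tau>. (p \<circ> (\<lambda>w. w - v)) w \<in> {..<e}}"
      using v e p0 by (simp add: top)
    moreover have "{w \<in> topspace \<tau>. (p \<circ> (\<lambda>w. w - v)) w \<in> {..<e}} \<subseteq> {v \<in> topspace \<tau>. \<phi> v \<in> U}"
    proof
      fix w assume w: "w \<in> {w \<in> topspace \<tau>. (p \<circ> (\<lambda>w. w - v)) w \<in> {..<e}}"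
      then have "\<phi> w - \<phi> v = \<phi> (w - v)"
        using \<phi>_add[of "w - v" v] v by (simp add: top)
      with w have "\<phi> w \<in> ball (\<phi> v) e"
        using le[of "w - v"] v by (auto simp: top dist_norm norm_minus_commute[of "\<phi> v"])
      with e w show "w \<in> {v \<in> topspace \<tau>. \<phi> v \<in> U}" by auto
    qed
    ultimately show "\<exists>S. openin \<tau> S \<and> v \<in> S \<and> S \<subseteq> {v \<in> topspace \<tau>. \<phi> v \<in> U}"
      by blast
  qed
  then have "continuous_map \<tau> euclidean \<phi>"
    by (simp add: continuous_map_def flip: open_openin)
  with \<phi> show ?thesis by (simp add: dual_def)
qed

text \<open>A neighbourhood of 0 that misses \<open>v\<close> contains a finite intersection of
  seminorm balls, so some seminorm in \<open>Q\<close> is positive at \<open>v\<close>. Hahn-Banach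
  gives a functional that is dominated by this seminorm, hence continuous, and attains it at
  \<open>v\<close>.\<close>

lemma dual_separates_points:
  assumes vs: "vector_space sc" and V: "hlcs sc V \<tau>" and Q: "fundamental_seminorms sc V \<tau> Q"
    and v: "v \<in> V" "v \<noteq> 0"
  obtains \<phi> where "\<phi> \<in> dual sc V \<tau>" "\<phi> v \<noteq> 0"
proof -
  have lcs: "lcs sc V \<tau>" and haus: "Hausdorff_space \<tau>"
    using V by (auto simp: hlcs_def)
  then have top: "topspace \<tau> = V" and sub: "module.subspace sc V"
    by (auto simp: lcs_def)
  interpret complex_subspace sc V
    using vs sub by (simp add: complex_subspace_def complex_subspace_axioms_def)
  obtain U where U: "openin \<tau> U" "0 \<in> U" "v \<notin> U"
    using haus v closed(1) unfolding Hausdorff_space_def top disjnt_def by blast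
  obtain P \<epsilon> where P: "P \<subseteq> Q" "0 < \<epsilon>" "{v \<in> V. \<forall>p\<in>P. p v < \<epsilon>} \<subseteq> U"
    using Q U unfolding fundamental_seminorms_def by blast
  then obtain p where p: "p \<in> P" "\<epsilon> \<le> p v"
    using U(3) v(1) by (force simp: not_less)
  then have semi: "seminorm_on sc V p" and cont: "continuous_map \<tau> euclideanreal p"
    using Q P(1) by (auto simp: fundamental_seminorms_def)
  obtain \<phi> where \<phi>: "\<phi> \<in> lin_maps sc V (*) UNIV" "\<And>v. v \<in> V \<Longrightarrow> cmod (\<phi> v) \<le> p v" "Re (\<phi> v) = p v"
    using hahn_banach_complex[OF semi v(1)] by blast
  have "p 0 = 0"
    using semi closed(1) unfolding seminorm_on_def by (metis mult_zero_left norm_zero scale_zero_left)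
  then have "\<phi> \<in> dual sc V \<tau>"
    by (intro dominated_linear_in_dual[OF lcs \<phi>(1) cont \<phi>(2)])
  moreover have "\<phi> v \<noteq> 0"
    using \<phi>(3) p P(2) by auto
  ultimately show thesis by (rule that)
qed

section \<open>Initial and finest locally convex topologies\<close>

lemma lin_mapsD:
  assumes "f \<in> lin_maps sc V sc' W"
  shows "v \<in> V \<Longrightarrow> f v \<in> W" "v \<notin> V \<Longrightarrow> f v = 0"
    "u \<in> V \<Longrightarrow> v \<in> V \<Longrightarrow> f (u + v) = f u + f v" "v \<in> V \<Longrightarrow> f (sc c v) = sc' c (f v)"
  using assms by (auto simp: lin_maps_def cprod_def)

lemma lin_maps_0:
  assumes "f \<in> lin_maps sc V sc' W"
  shows "f 0 = 0"
proof (cases "0 \<in> V")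
  case True
  then show ?thesis using lin_mapsD(3)[OF assms, of 0 0] by simp
qed (rule lin_mapsD(2)[OF assms])

text \<open>Open sets are traces of preimages and \<open>f\<close> is linear, so the operations are
  continuous because their composites with \<open>f\<close> are, and preimages of convex sets are
  convex. This supplies candidates for the supremum that defines the finest topology.\<close>

lemma lcs_pullback:
  assumes V: "complex_subspace sc V" and W: "lcs sc' W \<sigma>" and f: "f \<in> lin_maps sc V sc' W"
  shows "lcs sc V (pullback_topology V f \<sigma>)"
proof -
  interpret complex_subspace sc V by fact
  let ?\<tau> = "pullback_topology V f \<sigma>"
  note lin = lin_mapsD[OF f]
  have top\<sigma>: "topspace \<sigma> = W"
    and add: "continuous_map (prod_topology \<sigma> \<sigma>) \<sigma> (\<lambda>(u, v). u + v)"
    and scale: "continuous_map (prod_topology euclidean \<sigma>) \<sigma> (\<lambda>(c, v). sc' c v)"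
    and conv: "\<And>U. openin \<sigma> U \<Longrightarrow> 0 \<in> U \<Longrightarrow>
       \<exists>W N. openin \<sigma> N \<and> 0 \<in> N \<and> N \<subseteq> W \<and> W \<subseteq> U \<and> convex_set sc' W"
    using W by (auto simp: lcs_def)
  have top: "topspace ?\<tau> = V"
    using lin(1) by (auto simp: topspace_pullback_topology top\<sigma>)
  have cont: "continuous_map ?\<tau> \<sigma> f"
    using continuous_map_pullback[OF continuous_map_id, of V f \<sigma>] by simp
  have "continuous_map (prod_topology ?\<tau> ?\<tau>) (prod_topology \<sigma> \<sigma>) (\<lambda>(u, v). (f u, f v))"
    using cont by (subst continuous_map_prod_top) auto
  from continuous_map_compose[OF this add]
  have "continuous_map (prod_topology ?\<tau> ?\<tau>) \<sigma> (\<lambda>(u, v). f u + f v)"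
    by (simp add: o_def case_prod_unfold)
  then have "continuous_map (prod_topology ?\<tau> ?\<tau>) \<sigma> (f \<circ> (\<lambda>(u, v). u + v))"
    by (rule continuous_map_eq) (auto simp: top lin)
  then have add': "continuous_map (prod_topology ?\<tau> ?\<tau>) ?\<tau> (\<lambda>(u, v). u + v)"
    by (rule continuous_map_pullback') (auto simp: top)
  have "continuous_map (prod_topology euclidean ?\<tau>) (prod_topology euclidean \<sigma>) (\<lambda>(c, v). (c, f v))"
    using cont by (subst continuous_map_prod_top) auto
  from continuous_map_compose[OF this scale]
  have "continuous_map (prod_topology euclidean ?\<tau>) \<sigma> (\<lambda>(c, v). sc' c (f v))"
    by (simp add: o_def case_prod_unfold)
  then have "continuous_map (prod_topology euclidean ?\<tau>) \<sigma> (f \<circ> (\<lambda>(c, v). sc c v))"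
    by (rule continuous_map_eq) (auto simp: top lin)
  then have scale': "continuous_map (prod_topology euclidean ?\<tau>) ?\<tau> (\<lambda>(c, v). sc c v)"
    by (rule continuous_map_pullback') (auto simp: top)
  have "\<exists>W N. openin ?\<tau> N \<and> 0 \<in> N \<and> N \<subseteq> W \<and> W \<subseteq> U \<and> convex_set sc W"
    if U: "openin ?\<tau> U" "0 \<in> U" for U
  proof -
    obtain U' where U': "openin \<sigma> U'" "U = f -` U' \<inter> V"
      using U(1) by (auto simp: openin_pullback_topology)
    with U(2) have "0 \<in> U'" by (simp add: lin_maps_0[OF f])
    then obtain W N where WN: "openin \<sigma> N" "0 \<in> N" "N \<subseteq> W" "W \<subseteq> U'" "convex_set sc' W"
      using conv[OF U'(1)] by blast
    have "convex_set sc (f -` W \<inter> V)"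
      using WN(5) by (simp add: convex_set_def lin)
    moreover have "openin ?\<tau> (f -` N \<inter> V)"
      using WN(1) by (auto simp: openin_pullback_topology)
    ultimately show ?thesis
      using WN U'(2) by (intro exI[of _ "f -` W \<inter> V"] exI[of _ "f -` N \<inter> V"])
        (auto simp: lin_maps_0[OF f])
  qed
  with add' scale' top subspace show ?thesis
    by (simp add: lcs_def)
qed

section \<open>The finest locally convex topology\<close>

lemma finest_lc_topology_finer:
  assumes "lcs sc V \<sigma>" "\<And>x. x \<in> X \<Longrightarrow> continuous_map (\<tau> x) \<sigma> (h x)" "openin \<sigma> U"
  shows "openin (finest_lc_topology sc V X \<tau> h) U"
  unfolding finest_lc_topology_def using assms by (intro topology_generated_by_Basis) blast

text \<open>A supremum of locally convex topologies is locally convex: a map into it is continuous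
  once it is continuous into every admissible \<sigma>, and the identity from the supremum to
  \<sigma> is continuous, so the operations can be checked in each \<sigma>.\<close>

lemma lcs_finest_lc_topology:
  assumes \<sigma>0: "lcs sc V \<sigma>0" "\<And>x. x \<in> X \<Longrightarrow> continuous_map (\<tau> x) \<sigma>0 (h x)"
  shows "lcs sc V (finest_lc_topology sc V X \<tau> h)"
proof -
  define \<rho> where "\<rho> = finest_lc_topology sc V X \<tau> h"
  define B where "B = {U. \<exists>\<sigma>. lcs sc V \<sigma> \<and> (\<forall>x\<in>X. continuous_map (\<tau> x) \<sigma> (h x)) \<and> openin \<sigma> U}"
  have \<rho>: "\<rho> = topology_generated_by B"
    by (simp add: \<rho>_def B_def finest_lc_topology_def)
  have "U \<subseteq> V" if "U \<in> B" for U
    using that openin_subset by (fastforce simp: B_def lcs_def)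
  \<comment> \<open>The topology \<open>\<sigma>0\<close> guarantees that the family is nonempty, so
    that the generators cover \<open>V\<close>.\<close>
  moreover have "V \<in> B"
    using \<sigma>0 openin_topspace[of \<sigma>0] by (auto simp: B_def lcs_def)
  ultimately have UB: "\<Union>B = V" by blast
  then have top: "topspace \<rho> = V" by (simp add: \<rho>)
  have sub: "module.subspace sc V" using \<sigma>0(1) by (simp add: lcs_def)
  have id_cont: "continuous_map \<rho> \<sigma> (\<lambda>v. v)"
    if "lcs sc V \<sigma>" "\<forall>x\<in>X. continuous_map (\<tau> x) \<sigma> (h x)" for \<sigma>
  proof -
    have top\<sigma>: "topspace \<sigma> = V" using that(1) by (simp add: lcs_def)
    have "openin \<rho> {v \<in> V. v \<in> U}" if U: "openin \<sigma> U" for U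
    proof -
      have "{v \<in> V. v \<in> U} = U" using openin_subset[OF U] by (auto simp: top\<sigma>)
      moreover have "openin \<rho> U"
        unfolding \<rho>_def using \<open>lcs sc V \<sigma>\<close> _ U
        by (rule finest_lc_topology_finer) (simp add: \<open>\<forall>x\<in>X. continuous_map (\<tau> x) \<sigma> (h x)\<close>)
      ultimately show ?thesis by simp
    qed
    then show ?thesis by (simp add: continuous_map_def top top\<sigma>)
  qed
  have into: "continuous_map Z \<rho> f"
    if "\<And>\<sigma>. lcs sc V \<sigma> \<Longrightarrow> \<forall>x\<in>X. continuous_map (\<tau> x) \<sigma> (h x) \<Longrightarrow> continuous_map Z \<sigma> f" for f and Z :: "'z topology"
    unfolding \<rho>
  proof (rule continuous_on_generated_topo)
    fix U assume "U \<in> B"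
    then obtain \<sigma> where \<sigma>: "lcs sc V \<sigma>" "\<forall>x\<in>X. continuous_map (\<tau> x) \<sigma> (h x)" "openin \<sigma> U"
      by (auto simp: B_def)
    then show "openin Z (f -` U \<inter> topspace Z)"
      using that[OF \<sigma>(1,2)] by (simp add: continuous_map_alt)
  next
    have "continuous_map Z \<sigma>0 f" using \<sigma>0 by (intro that) auto
    then show "f ` topspace Z \<subseteq> \<Union>B"
      using \<sigma>0(1) UB by (auto simp: continuous_map_def lcs_def)
  qed
  have add: "continuous_map (prod_topology \<rho> \<rho>) \<rho> (\<lambda>(u, v). u + v)"
  proof (rule into)
    fix \<sigma> assume \<sigma>: "lcs sc V \<sigma>" "\<forall>x\<in>X. continuous_map (\<tau> x) \<sigma> (h x)"
    have "continuous_map (prod_topology \<rho> \<rho>) (prod_topology \<sigma> \<sigma>) (\<lambda>(u, v). (u, v))"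
      using id_cont[OF \<sigma>] by (subst continuous_map_prod_top) auto
    moreover have "continuous_map (prod_topology \<sigma> \<sigma>) \<sigma> (\<lambda>(u, v). u + v)"
      using \<sigma>(1) by (simp add: lcs_def)
    ultimately have "continuous_map (prod_topology \<rho> \<rho>) \<sigma> ((\<lambda>(u, v). u + v) \<circ> (\<lambda>(u, v). (u, v)))"
      by (rule continuous_map_compose)
    then show "continuous_map (prod_topology \<rho> \<rho>) \<sigma> (\<lambda>(u, v). u + v)"
      by (simp add: o_def case_prod_unfold)
  qed
  have scale: "continuous_map (prod_topology euclidean \<rho>) \<rho> (\<lambda>(c, v). sc c v)"
  proof (rule into)
    fix \<sigma> assume \<sigma>: "lcs sc V \<sigma>" "\<forall>x\<in>X. continuous_map (\<tau> x) \<sigma> (h x)"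
    have "continuous_map (prod_topology euclidean \<rho>) (prod_topology euclidean \<sigma>) (\<lambda>(c, v). (c, v))"
      using id_cont[OF \<sigma>] by (subst continuous_map_prod_top) auto
    moreover have "continuous_map (prod_topology euclidean \<sigma>) \<sigma> (\<lambda>(c, v). sc c v)"
      using \<sigma>(1) by (simp add: lcs_def)
    ultimately have "continuous_map (prod_topology euclidean \<rho>) \<sigma> ((\<lambda>(c, v). sc c v) \<circ> (\<lambda>(c, v). (c, v)))"
      by (rule continuous_map_compose)
    then show "continuous_map (prod_topology euclidean \<rho>) \<sigma> (\<lambda>(c, v). sc c v)"
      by (simp add: o_def case_prod_unfold)
  qed
  have "\<exists>W N. openin \<rho> N \<and> 0 \<in> N \<and> N \<subseteq> W \<and> W \<subseteq> U \<and> convex_set sc W"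
    if "openin \<rho> U" "0 \<in> U" for U
  proof -
    from that(1) have "generate_topology_on B U"
      unfolding \<rho> by (rule openin_topology_generated_by)
    \<comment> \<open>Induction on the generation of \<open>U\<close>: for an intersection the
      convex sets are intersected, for a union one member containing 0 is enough, and a generator
      inherits the sets from its own \<sigma>.\<close>
    then show ?thesis using that(2)
    proof induction
      case (Int U1 U2)
      then obtain W1 N1 W2 N2 where
        "openin \<rho> N1" "0 \<in> N1" "N1 \<subseteq> W1" "W1 \<subseteq> U1" "convex_set sc W1"
        "openin \<rho> N2" "0 \<in> N2" "N2 \<subseteq> W2" "W2 \<subseteq> U2" "convex_set sc W2"
        by (metis IntD1 IntD2)
      then show ?case
        by (intro exI[of _ "W1 \<inter> W2"] exI[of _ "N1 \<inter> N2"]) (auto simp: convex_set_def)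
    next
      case (UN K)
      then show ?case by (meson Sup_upper UnionE order_trans)
    next
      case (Basis U)
      then obtain \<sigma> where \<sigma>: "lcs sc V \<sigma>" "\<forall>x\<in>X. continuous_map (\<tau> x) \<sigma> (h x)" "openin \<sigma> U"
        by (auto simp: B_def)
      then obtain W N where WN: "openin \<sigma> N" "0 \<in> N" "N \<subseteq> W" "W \<subseteq> U" "convex_set sc W"
        using Basis(2) unfolding lcs_def by blast
      have "openin \<rho> N"
        unfolding \<rho>_def by (rule finest_lc_topology_finer[OF \<sigma>(1) _ WN(1)]) (use \<sigma>(2) in blast)
      with WN show ?case by blast
    qed simp
  qed
  with add scale top sub show ?thesis
    by (simp add: lcs_def \<rho>_def)
qed

text \<open>The universal property. The pullback of \<sigma> along \<open>f\<close> is locally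
  convex and makes every \<open>h x\<close> continuous, so the finest topology refines it, which is
  continuity of \<open>f\<close>. The same pullback shows that an admissible topology exists, whence
  the second claim.\<close>

lemma continuous_map_finest_lc_topology:
  assumes V: "complex_subspace sc V" and W: "lcs sc' W \<sigma>" and f: "f \<in> lin_maps sc V sc' W"
    and h: "\<And>x. x \<in> X \<Longrightarrow> h x ` topspace (\<tau> x) \<subseteq> V"
    and fh: "\<And>x. x \<in> X \<Longrightarrow> continuous_map (\<tau> x) \<sigma> (f \<circ> h x)"
  shows "continuous_map (finest_lc_topology sc V X \<tau> h) \<sigma> f"
    and "lcs sc V (finest_lc_topology sc V X \<tau> h)"
proof -
  let ?\<pi> = "pullback_topology V f \<sigma>"
  have lcs: "lcs sc V ?\<pi>" by (rule lcs_pullback[OF V W f])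
  have h_cont: "continuous_map (\<tau> x) ?\<pi> (h x)" if "x \<in> X" for x
    using h[OF that] by (intro continuous_map_pullback' fh that) auto
  show *: "lcs sc V (finest_lc_topology sc V X \<tau> h)"
    by (rule lcs_finest_lc_topology[OF lcs h_cont])
  then have top: "topspace (finest_lc_topology sc V X \<tau> h) = V"
    by (simp add: lcs_def)
  have "openin (finest_lc_topology sc V X \<tau> h) (f -` U \<inter> V)" if "openin \<sigma> U" for U
    using that by (intro finest_lc_topology_finer[OF lcs h_cont]) (auto simp: openin_pullback_topology)
  then show "continuous_map (finest_lc_topology sc V X \<tau> h) \<sigma> f"
    using W lin_mapsD(1)[OF f] by (auto simp: continuous_map_alt top lcs_def)
qed

section \<open>Weak integrals\<close>

text \<open>All functionals agree on two weak integrals of \<open>F\<close>, so they vanish on the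
  difference, which is 0 by separation. This justifies the definite description in
  \<open>weak_integral\<close>.\<close>

lemma weak_integral_eqI:
  assumes V: "complex_subspace sc V"
    and sep: "\<And>v. v \<in> V \<Longrightarrow> v \<noteq> 0 \<Longrightarrow> \<exists>\<phi>\<in>dual sc V \<tau>. \<phi> v \<noteq> 0"
    and I: "is_weak_integral T sc V \<tau> \<nu> F I"
  shows "weak_integral T sc V \<tau> \<nu> F = I"
  unfolding weak_integral_def
proof (rule the_equality)
  interpret complex_subspace sc V by fact
  fix J assume J: "is_weak_integral T sc V \<tau> \<nu> F J"
  have IJ: "I \<in> V" "J \<in> V" using I J by (auto simp: is_weak_integral_def)
  have "\<phi> (J - I) = 0" if \<phi>: "\<phi> \<in> dual sc V \<tau>" for \<phi>
  proof -
    have "\<phi> I = \<phi> J" using I J \<phi> unfolding is_weak_integral_def by metis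
    moreover have "\<phi> ((J - I) + I) = \<phi> (J - I) + \<phi> I"
      by (rule lin_mapsD(3)[of \<phi> sc V "(*)" UNIV]) (use \<phi> IJ in \<open>auto simp: dual_def\<close>)
    ultimately show ?thesis by simp
  qed
  then show "J = I"
    using sep[of "J - I"] IJ by auto
qed (rule I)

lemma dual_comp:
  assumes f: "f \<in> lin_maps sc V sc' W" "continuous_map \<tau> \<sigma> f" and \<phi>: "\<phi> \<in> dual sc' W \<sigma>"
  shows "\<phi> \<circ> f \<in> dual sc V \<tau>"
proof -
  have \<phi>': "\<phi> \<in> lin_maps sc' W (*) UNIV" "continuous_map \<sigma> euclidean \<phi>"
    using \<phi> by (auto simp: dual_def)
  have "\<phi> \<circ> f \<in> lin_maps sc V (*) UNIV"
    using lin_mapsD[OF f(1)] lin_mapsD[OF \<phi>'(1)] lin_maps_0[OF \<phi>'(1)]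
    by (auto simp: lin_maps_def cprod_def)
  with continuous_map_compose[OF f(2) \<phi>'(2)] show ?thesis
    by (simp add: dual_def)
qed

text \<open>A functional on \<open>W\<close> composed with \<open>f\<close> is a functional on
  \<open>V\<close>, and there \<open>I\<close> already represents the integrals.\<close>

lemma is_weak_integral_map:
  assumes f: "f \<in> lin_maps sc V sc' W" "continuous_map \<tau> \<sigma> f"
    and I: "is_weak_integral T sc V \<tau> \<nu> F I"
  shows "is_weak_integral T sc' W \<sigma> \<nu> (f \<circ> F) (f I)"
proof -
  have "\<phi> (f I) = ess_integral T \<nu> (\<lambda>s. \<phi> (f (F s)))" if "\<phi> \<in> dual sc' W \<sigma>" for \<phi>
    using dual_comp[OF f that] I by (auto simp: is_weak_integral_def)
  moreover have "f I \<in> W"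
    using I lin_mapsD(1)[OF f(1)] by (simp add: is_weak_integral_def)
  ultimately show ?thesis by (simp add: is_weak_integral_def)
qed

lemma L1_map:
  assumes f: "f \<in> lin_maps sc V sc' W" "continuous_map \<tau> \<sigma> f" and F: "F \<in> L1 T sc V \<tau> \<nu>"
  shows "f \<circ> F \<in> L1 T sc' W \<sigma> \<nu>"
proof -
  have "f \<circ> F \<in> cpower W (topspace T)"
    using F lin_mapsD(1)[OF f(1)] lin_maps_0[OF f(1)] by (auto simp: L1_def cprod_def)
  moreover have "ess_integrable T \<nu> (\<lambda>s. \<phi> (f (F s)))" if "\<phi> \<in> dual sc' W \<sigma>" for \<phi>
    using dual_comp[OF f that] F by (auto simp: L1_def)
  moreover have "\<exists>I. is_weak_integral T sc' W \<sigma> \<nu> (f \<circ> F) I"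
    using F is_weak_integral_map[OF f] unfolding L1_def by blast
  ultimately show ?thesis
    by (simp add: L1_def)
qed

section \<open>Consistent classes of data\<close>

lemma lin_maps_add:
  assumes "vector_space sc'" "module.subspace sc' W" "f \<in> lin_maps sc V sc' W" "g \<in> lin_maps sc V sc' W"
  shows "f + g \<in> lin_maps sc V sc' W"
proof -
  interpret complex_subspace sc' W
    using assms by (simp add: complex_subspace_def complex_subspace_axioms_def)
  show ?thesis
    using assms(3,4) by (auto simp: lin_maps_def cprod_def scale_right_distrib algebra_simps)
qed

lemma lin_maps_scale:
  assumes "vector_space sc'" "module.subspace sc' W" "f \<in> lin_maps sc V sc' W"
  shows "fscale sc' c f \<in> lin_maps sc V sc' W"
proof -
  interpret complex_subspace sc' W
    using assms by (simp add: complex_subspace_def complex_subspace_axioms_def)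
  show ?thesis
    using assms(3)
    by (auto simp: lin_maps_def cprod_def fscale_def scale_right_distrib mult.commute)
qed

context consistent_data
begin

section \<open>The space \<open>G\<close> and its components\<close>

abbreviation "G \<equiv> G_space X E H A"
abbreviation "tG \<equiv> G_top sc X E \<tau> H A"
abbreviation "L x \<equiv> cont_end sc (E x) (tE x)"
abbreviation "G_map u \<equiv> rest H (theta X E u)"

text \<open>The outer restriction to \<open>G\<close> makes this an element of
  \<open>lin_maps\<close>, whose members vanish off their domain; the inner one makes the values
  vanish off \<open>E x\<close>.\<close>

definition component :: "'x \<Rightarrow> (('x \<Rightarrow> 'e) \<Rightarrow> 'x \<Rightarrow> 'e) \<Rightarrow> 'e \<Rightarrow> 'e"
  where "component x = rest G (\<lambda>g. rest (E x) (Pr x \<circ> g \<circ> inj_at x))"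

sublocale sc: vector_space sc by (rule vs)
sublocale fsc: vector_space "fscale sc" by (rule vector_space_fscale[OF vs])
sublocale ffsc: vector_space "fscale (fscale sc)" by (rule vector_space_fscale[OF fsc.vector_space_axioms])

lemma complex_subspace_E: "x \<in> X \<Longrightarrow> complex_subspace sc (E x)"
  using E vs by (simp add: complex_subspace_def complex_subspace_axioms_def hlcs_def lcs_def)

lemma complex_subspace_L: "x \<in> X \<Longrightarrow> complex_subspace (fscale sc) (L x)"
  using \<tau> fsc.vector_space_axioms
  by (simp add: complex_subspace_def complex_subspace_axioms_def hlcs_def lcs_def)

lemma complex_subspace_H: "complex_subspace (fscale sc) H"
  using H fsc.vector_space_axioms
  by (simp add: complex_subspace_def complex_subspace_axioms_def hlcs_def lcs_def)

lemma A_component: "u \<in> A \<Longrightarrow> x \<in> X \<Longrightarrow> u x \<in> lin_maps sc (E x) sc (E x)"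
  using A_subset by (auto simp: cprod_def cont_end_def End_def)

lemma A_component_cont: "u \<in> A \<Longrightarrow> x \<in> X \<Longrightarrow> u x \<in> L x"
  using A_subset by (auto simp: cprod_def)

lemma A_outside: "u \<in> A \<Longrightarrow> x \<notin> X \<Longrightarrow> u x = 0"
  using A_subset by (auto simp: cprod_def)

lemma G_map_apply: "v \<in> H \<Longrightarrow> G_map u v = (\<lambda>x. u x (v x))"
  using H_subset by (auto simp: rest_def theta_def Pr_def)

lemma G_map_outside: "v \<notin> H \<Longrightarrow> G_map u v = 0"
  by (simp add: rest_def)

lemma G_map_add: "G_map (u + w) = G_map u + G_map w"
proof
  fix v show "G_map (u + w) v = (G_map u + G_map w) v"
    by (cases "v \<in> H") (simp_all add: G_map_apply G_map_outside fun_eq_iff)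
qed

lemma G_map_scale: "G_map (fscale (fscale sc) c u) = fscale (fscale sc) c (G_map u)"
proof
  fix v show "G_map (fscale (fscale sc) c u) v = fscale (fscale sc) c (G_map u) v"
    by (cases "v \<in> H") (simp_all add: G_map_apply G_map_outside fun_eq_iff fscale_def)
qed

lemma G_map_in_G: "u \<in> A \<Longrightarrow> G_map u \<in> G"
  by (auto simp: G_space_def)

text \<open>\<open>G\<close> is the image of the subspace \<open>A\<close> under the linear map
  \<open>u \<mapsto> G_map u\<close>.\<close>

lemma complex_subspace_G: "complex_subspace (fscale (fscale sc)) G"
proof -
  have "ffsc.subspace G"
  proof (rule ffsc.subspaceI)
    have "G_map 0 = 0"
      using G_map_scale[of 0 0] by simp
    then show "0 \<in> G"
      using G_map_in_G[OF ffsc.subspace_0[OF A]] by simp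
  next
    fix g h assume "g \<in> G" "h \<in> G"
    then obtain u w where "u \<in> A" "w \<in> A" "g = G_map u" "h = G_map w"
      by (auto simp: G_space_def)
    then show "g + h \<in> G"
      using G_map_in_G[OF ffsc.subspace_add[OF A]] by (simp add: G_map_add)
  next
    fix c g assume "g \<in> G"
    then obtain u where "u \<in> A" "g = G_map u"
      by (auto simp: G_space_def)
    then show "fscale (fscale sc) c g \<in> G"
      using G_map_in_G[OF ffsc.subspace_scale[OF A]] by (simp add: G_map_scale[symmetric])
  qed
  then show ?thesis
    using ffsc.vector_space_axioms by (simp add: complex_subspace_def complex_subspace_axioms_def)
qed

lemma G_subset: "G \<subseteq> cont_end (fscale sc) H tH"
  using theta_A by (auto simp: G_space_def)

text \<open>For \<open>e\<close> in \<open>E x\<close> the vector \<open>inj_at x e\<close> lies in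
  \<open>H\<close>, and \<open>G_map u\<close> acts on its coordinate \<open>x\<close> by
  \<open>u x\<close>; off \<open>E x\<close> both sides are 0. Thus \<open>component x\<close>
  recovers a coordinate of \<open>u\<close>, and facts about \<open>G\<close> reduce to facts about
  \<open>A\<close>.\<close>

lemma component_G_map:
  assumes "u \<in> A" "x \<in> X"
  shows "component x (G_map u) = u x"
proof
  fix e
  show "component x (G_map u) e = u x e"
  proof (cases "e \<in> E x")
    case True
    then have "inj_at x e \<in> H" using inj_H[OF assms(2)] by blast
    with True show ?thesis
      using assms by (simp add: component_def rest_def[of G] G_map_in_G)
        (simp add: rest_def[of "E x"] G_map_apply Pr_def inj_at_def)
  next
    case False
    then show ?thesis
      using assms lin_mapsD(2)[OF A_component[OF assms]]
      by (simp add: component_def rest_def[of G] G_map_in_G) (simp add: rest_def)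
  qed
qed

lemma component_lin:
  assumes x: "x \<in> X"
  shows "component x \<in> lin_maps (fscale (fscale sc)) G (fscale sc) (L x)"
proof -
  have "component x g \<in> L x" if "g \<in> G" for g
    using that A_component_cont x by (auto simp: G_space_def component_G_map)
  moreover have "component x (g + h) = component x g + component x h" if gh: "g \<in> G" "h \<in> G" for g h
  proof -
    obtain u w where uw: "u \<in> A" "w \<in> A" "g = G_map u" "h = G_map w"
      using gh by (auto simp: G_space_def)
    then have "component x (g + h) = (u + w) x"
      using component_G_map[OF ffsc.subspace_add[OF A] x] by (simp add: G_map_add)
    with uw show ?thesis by (simp add: component_G_map x)
  qed
  moreover have "component x (fscale (fscale sc) c g) = fscale sc c (component x g)" if g: "g \<in> G" for c g
  proof -
    obtain u where u: "u \<in> A" "g = G_map u"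
      using g by (auto simp: G_space_def)
    then have "component x (fscale (fscale sc) c g) = fscale (fscale sc) c u x"
      using component_G_map[OF ffsc.subspace_scale[OF A] x] by (simp add: G_map_scale[symmetric])
    with u show ?thesis by (simp add: component_G_map x fscale_def)
  qed
  moreover have "component x g = 0" if "g \<notin> G" for g
    using that by (simp add: component_def rest_def)
  ultimately show ?thesis
    by (simp add: lin_maps_def cprod_def)
qed

section \<open>The topology of \<open>G\<close>\<close>

lemma topspace_\<tau>: "x \<in> X \<Longrightarrow> topspace (\<tau> x) = L x"
  using \<tau> by (simp add: hlcs_def lcs_def)

text \<open>Writes the defining maps of the topology as elements induced by \<open>A\<close>, so
  that \<open>inj_A\<close> places them in \<open>G\<close> and \<open>component_G_map\<close>
  evaluates their components.\<close>

lemma h_map_eq: "h_map H x f = G_map (inj_at x f)"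
proof
  fix v show "h_map H x f v = G_map (inj_at x f) v"
  proof (cases "v \<in> H")
    case True
    then show ?thesis
      by (simp add: G_map_apply) (auto simp: h_map_def rest_def Pr_def inj_at_def fun_eq_iff)
  qed (simp add: h_map_def rest_def)
qed

lemma h_map_in_G:
  assumes "x \<in> X"
  shows "h_map H x ` topspace (\<tau> x) \<subseteq> G"
  using inj_A[OF assms] assms by (auto simp: topspace_\<tau> h_map_eq intro!: G_map_in_G)

text \<open>The zero map into \<open>H\<close> serves as test map: its pullback is the indiscrete
  topology on \<open>G\<close>, an admissible one that requires no choice of a point of
  \<open>X\<close>.\<close>

lemma lcs_G: "lcs (fscale (fscale sc)) G tG"
  unfolding G_top_def
proof (rule continuous_map_finest_lc_topology(2)[where f = 0 and \<sigma> = tH and W = H, OF complex_subspace_G])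
  interpret H: complex_subspace "fscale sc" H by (rule complex_subspace_H)
  show "lcs (fscale sc) H tH" using H by (simp add: hlcs_def)
  then have "topspace tH = H" by (simp add: lcs_def)
  then show "continuous_map (\<tau> x) tH (0 \<circ> h_map H x)" for x
    by (simp add: o_def)
  show "0 \<in> lin_maps (fscale (fscale sc)) G (fscale sc) H"
    by (simp add: lin_maps_def cprod_def)
qed (rule h_map_in_G)

text \<open>By the universal property of the topology of \<open>G\<close>: \<open>component x \<circ> h_map H y\<close> is the identity
  if \<open>y = x\<close> and zero otherwise.\<close>

lemma component_continuous:
  assumes x: "x \<in> X"
  shows "continuous_map tG (\<tau> x) (component x)"
  unfolding G_top_def
proof (rule continuous_map_finest_lc_topology(1)[OF complex_subspace_G _ component_lin[OF x] h_map_in_G])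
  show "lcs (fscale sc) (L x) (\<tau> x)" using \<tau>[OF x] by (simp add: hlcs_def)
  fix y assume y: "y \<in> X"
  interpret L: complex_subspace "fscale sc" "L x" by (rule complex_subspace_L[OF x])
  have eq: "(component x \<circ> h_map H y) f = inj_at y f x" if "f \<in> topspace (\<tau> y)" for f
    using that component_G_map[OF _ x, of "inj_at y f"] inj_A[OF y] y by (auto simp: topspace_\<tau> h_map_eq)
  have "continuous_map (\<tau> y) (\<tau> x) (\<lambda>f. inj_at y f x)"
    by (cases "x = y") (simp_all add: inj_at_def topspace_\<tau> x)
  then show "continuous_map (\<tau> y) (\<tau> x) (component x \<circ> h_map H y)"
    by (rule continuous_map_eq) (rule eq[symmetric])
qed

text \<open>The components of \<open>g\<close> are the coordinates of some \<open>u\<close> in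
  \<open>A\<close> over \<open>X\<close>. Members of \<open>A\<close> vanish at indices outside
  \<open>X\<close>, so if all these coordinates are 0 then \<open>u = 0\<close> and
  \<open>g = 0\<close>.\<close>

lemma component_separates:
  assumes g: "g \<in> G" "g \<noteq> 0"
  obtains x where "x \<in> X" "component x g \<noteq> 0"
proof -
  obtain u where u: "u \<in> A" "g = G_map u" using g(1) by (auto simp: G_space_def)
  have "\<exists>x\<in>X. u x \<noteq> 0"
  proof (rule ccontr)
    assume "\<not> (\<exists>x\<in>X. u x \<noteq> 0)"
    then have "u = 0" using A_outside[OF u(1)] by fastforce
    then have "g = 0" using u(2) G_map_scale[of 0 0] by simp
    with g(2) show False ..
  qed
  with u that show thesis by (metis component_G_map)
qed

section \<open>Separation by functionals and the Hausdorff property\<close>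

lemma dual_L_separates:
  assumes "x \<in> X" "f \<in> L x" "f \<noteq> 0"
  shows "\<exists>\<phi>\<in>dual (fscale sc) (L x) (\<tau> x). \<phi> f \<noteq> 0"
  using dual_separates_points[OF fsc.vector_space_axioms \<tau> Q\<tau>] assms by metis

text \<open>A functional on \<open>L x\<close> that detects a nonzero component is pulled back along
  \<open>component x\<close>; no seminorms on \<open>G\<close> enter.\<close>

lemma dual_G_separates:
  assumes "g \<in> G" "g \<noteq> 0"
  shows "\<exists>\<phi>\<in>dual (fscale (fscale sc)) G tG. \<phi> g \<noteq> 0"
proof -
  obtain x where x: "x \<in> X" "component x g \<noteq> 0" using component_separates[OF assms] .
  then obtain \<phi> where "\<phi> \<in> dual (fscale sc) (L x) (\<tau> x)" "\<phi> (component x g) \<noteq> 0"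
    using dual_L_separates[OF x(1) lin_mapsD(1)[OF component_lin[OF x(1)] assms(1)]] by blast
  then show ?thesis
    using dual_comp[OF component_lin[OF x(1)] component_continuous[OF x(1)]] by (metis comp_apply)
qed

text \<open>Distinct elements have a differing component; disjoint open sets around its two values
  in \<open>L x\<close> pull back to \<open>G\<close> by continuity of
  \<open>component x\<close>.\<close>

lemma hlcs_G: "hlcs (fscale (fscale sc)) G tG"
proof -
  interpret G: complex_subspace "fscale (fscale sc)" G by (rule complex_subspace_G)
  have top: "topspace tG = G" using lcs_G by (simp add: lcs_def)
  have "\<exists>U V. openin tG U \<and> openin tG V \<and> g \<in> U \<and> h \<in> V \<and> disjnt U V"
    if gh: "g \<in> G" "h \<in> G" "g \<noteq> h" for g h
  proof -
    obtain x where x: "x \<in> X" "component x (g - h) \<noteq> 0"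
      using component_separates[of "g - h"] gh by auto
    have "component x ((g - h) + h) = component x (g - h) + component x h"
      using gh by (intro lin_mapsD(3)[OF component_lin[OF x(1)]]) auto
    with x have ne: "component x g \<noteq> component x h" by auto
    have "component x g \<in> topspace (\<tau> x)" "component x h \<in> topspace (\<tau> x)"
      using gh lin_mapsD(1)[OF component_lin[OF x(1)]] by (simp_all add: topspace_\<tau> x(1))
    then obtain U V where UV: "openin (\<tau> x) U" "openin (\<tau> x) V" "component x g \<in> U" "component x h \<in> V" "disjnt U V"
      using \<tau>[OF x(1)] ne unfolding hlcs_def Hausdorff_space_def by blast
    show ?thesis
      using openin_continuous_map_preimage[OF component_continuous[OF x(1)] UV(1)]
        openin_continuous_map_preimage[OF component_continuous[OF x(1)] UV(2)] UV(3-5) gh(1,2)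
      by (intro exI[of _ "{g \<in> topspace tG. component x g \<in> U}"] exI[of _ "{g \<in> topspace tG. component x g \<in> V}"])
        (auto simp: top disjnt_def)
  qed
  then have "Hausdorff_space tG"
    by (simp add: Hausdorff_space_def top)
  with lcs_G show ?thesis by (simp add: hlcs_def)
qed

section \<open>The map \<open>Psi\<close> and weak integrals\<close>

lemma Psi_eq_component:
  assumes x: "x \<in> X" and F: "F \<in> L1 T (fscale (fscale sc)) G tG \<nu>"
  shows "Psi X E T F x = component x \<circ> F"
proof
  fix s
  show "Psi X E T F x s = (component x \<circ> F) s"
  proof (cases "s \<in> topspace T")
    case True
    then have "F s \<in> G" using F by (simp add: L1_def cprod_def)
    with True x show ?thesis
      by (simp add: Psi_def component_def rest_def)
  next
    case False
    then have "F s = 0" using F by (simp add: L1_def cprod_def)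
    with False x show ?thesis
      using lin_maps_0[OF component_lin[OF x]] by (simp add: Psi_def rest_def)
  qed
qed

lemma Psi_L1:
  assumes "x \<in> X" "F \<in> L1 T (fscale (fscale sc)) G tG \<nu>"
  shows "Psi X E T F x \<in> L1 T (fscale sc) (L x) (\<tau> x) \<nu>"
  unfolding Psi_eq_component[OF assms]
  using assms(2) by (rule L1_map[OF component_lin[OF assms(1)] component_continuous[OF assms(1)]])

lemma weak_integral_Psi:
  assumes x: "x \<in> X" and F: "F \<in> L1 T (fscale (fscale sc)) G tG \<nu>" and v: "v \<in> H"
  shows "weak_integral T (fscale sc) (L x) (\<tau> x) \<nu> (Psi X E T F x) (v x) =
    weak_integral T (fscale (fscale sc)) G tG \<nu> F v x"
proof -
  obtain I where I: "is_weak_integral T (fscale (fscale sc)) G tG \<nu> F I"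
    using F by (auto simp: L1_def)
  \<comment> \<open>The weak integral lies in \<open>G\<close> by definition, hence is induced by
    some \<open>u\<close> in \<open>A\<close>; both sides of the claim become
    \<open>u x (v x)\<close>.\<close>
  then obtain u where u: "u \<in> A" "I = G_map u"
    by (auto simp: is_weak_integral_def G_space_def)
  have "weak_integral T (fscale sc) (L x) (\<tau> x) \<nu> (Psi X E T F x) = component x I"
    unfolding Psi_eq_component[OF x F]
    using dual_L_separates[OF x]
    by (intro weak_integral_eqI[OF complex_subspace_L[OF x]]
        is_weak_integral_map[OF component_lin[OF x] component_continuous[OF x] I])
  moreover have "weak_integral T (fscale (fscale sc)) G tG \<nu> F = I"
    using dual_G_separates I by (intro weak_integral_eqI[OF complex_subspace_G])
  ultimately show ?thesis
    using u v x by (simp add: component_G_map) (simp add: G_map_apply)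
qed

text \<open>\<open>Psi\<close> is additive and homogeneous on all functions. The restriction to
  \<open>EH\<close> gives it the default value 0 off its domain, and closure of \<open>EH\<close>
  under the operations keeps the restricted map linear.\<close>

lemma Psi_lin:
  fixes T :: "'t topology"
  defines "EH \<equiv> cpower (End (fscale sc) H) (topspace T)"
  shows "rest EH (Psi X E T) \<in> lin_maps
    (fscale (fscale (fscale sc))) EH
    (fscale (fscale (fscale sc))) (cprod X (\<lambda>x. cpower (End sc (E x)) (topspace T)))"
proof -
  interpret H: complex_subspace "fscale sc" H by (rule complex_subspace_H)
  have EH_add: "F + F' \<in> EH" if "F \<in> EH" "F' \<in> EH" for F F'
    using that by (auto simp: EH_def cprod_def End_def
        intro!: lin_maps_add[OF fsc.vector_space_axioms H.subspace])
  have EH_scale: "fscale (fscale (fscale sc)) c F \<in> EH" if "F \<in> EH" for c F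
    using that lin_maps_scale[OF fsc.vector_space_axioms H.subspace, of _ "fscale sc" H c]
    by (auto simp: EH_def cprod_def End_def fscale_def[of "fscale (fscale sc)"])
  have Psi_End: "rest (E x) (Pr x \<circ> f \<circ> inj_at x) \<in> End sc (E x)"
    if x: "x \<in> X" and f: "f \<in> End (fscale sc) H" for x f
  proof -
    interpret E: complex_subspace sc "E x" by (rule complex_subspace_E[OF x])
    have f: "f \<in> lin_maps (fscale sc) H (fscale sc) H" using f by (simp add: End_def)
    have inH: "inj_at x e \<in> H" if "e \<in> E x" for e
      using inj_H[OF x] that by blast
    \<comment> \<open>The values of \<open>f\<close> lie in \<open>H\<close>, hence in the product,
      so their coordinate \<open>x\<close> is in \<open>E x\<close>.\<close>
    have "f (inj_at x e) x \<in> E x" if "e \<in> E x" for e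
      using lin_mapsD(1)[OF f inH[OF that]] H_subset x by (auto simp: cprod_def)
    moreover have "inj_at x (e + e') = inj_at x e + inj_at x e'" for e e' :: 'e
      by (auto simp: inj_at_def)
    moreover have "inj_at x (sc c e) = fscale sc c (inj_at x e)" for c e
      by (auto simp: inj_at_def fscale_def)
    ultimately show ?thesis
      using lin_mapsD(3,4)[OF f] inH
      by (simp add: End_def lin_maps_def cprod_def rest_def Pr_def) (simp add: fscale_def)
  qed
  have "Psi X E T F \<in> cprod X (\<lambda>x. cpower (End sc (E x)) (topspace T))" if "F \<in> EH" for F
    using that Psi_End by (auto simp: EH_def cprod_def[of "topspace T"] cprod_def[of X] Psi_def rest_def[of X] rest_def[of "topspace T"])
  moreover have "Psi X E T (F + F') = Psi X E T F + Psi X E T F'" for F F'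
    by (auto simp: Psi_def rest_def Pr_def fun_eq_iff)
  moreover have "Psi X E T (fscale (fscale (fscale sc)) c F) = fscale (fscale (fscale sc)) c (Psi X E T F)" for c F
    by (auto simp: Psi_def rest_def Pr_def fun_eq_iff fscale_def)
  ultimately show ?thesis
    using EH_add EH_scale by (simp add: lin_maps_def cprod_def[of EH] rest_def[of EH])
qed

text \<open>For each \<open>T\<close> the restricted \<open>Psi\<close> is the witness; it does not
  depend on the measure. It agrees with \<open>Psi\<close> on integrable maps, because these take
  values in \<open>G\<close>, which consists of endomorphisms of \<open>H\<close>.\<close>

lemma U_space_G:
  assumes D: "D \<subseteq> H"
  shows "U_space TYPE('t) sc X E tE \<tau> H tH D G tG"
  unfolding U_space_def
proof (intro conjI allI impI)
  fix T :: "'t topology"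
  let ?EH = "cpower (End (fscale sc) H) (topspace T)"
  let ?\<Psi> = "rest ?EH (Psi X E T)"
  have L1_EH: "?\<Psi> F = Psi X E T F" if "F \<in> L1 T (fscale (fscale sc)) G tG \<nu>" for F \<nu>
  proof -
    have "F \<in> ?EH"
      using that G_subset by (auto simp: L1_def cprod_def cont_end_def)
    then show ?thesis by (simp add: rest_def)
  qed
  have "Psi X E T F \<in> cprod X (\<lambda>x. L1 T (fscale sc) (L x) (\<tau> x) \<nu>)"
    if "F \<in> L1 T (fscale (fscale sc)) G tG \<nu>" for F \<nu>
    using Psi_L1[OF _ that] by (auto simp: cprod_def[of X]) (simp add: Psi_def rest_def)
  then have "\<forall>\<nu>. radon_measure T \<nu> \<longrightarrow>
      ?\<Psi> ` L1 T (fscale (fscale sc)) G tG \<nu> \<subseteq> cprod X (\<lambda>x. L1 T (fscale sc) (L x) (\<tau> x) \<nu>) \<and>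
      (\<forall>F \<in> L1 T (fscale (fscale sc)) G tG \<nu>. \<forall>v\<in>D. \<forall>x\<in>X.
        weak_integral T (fscale sc) (L x) (\<tau> x) \<nu> (?\<Psi> F x) (v x) =
        weak_integral T (fscale (fscale sc)) G tG \<nu> F v x)"
    using weak_integral_Psi[OF _ _ subsetD[OF D]] by (auto simp: L1_EH image_subset_iff)
  then show "\<exists>\<Psi>\<in>lin_maps (fscale (fscale (fscale sc))) ?EH (fscale (fscale (fscale sc)))
         (cprod X (\<lambda>x. cpower (End sc (E x)) (topspace T))). \<forall>\<nu>. radon_measure T \<nu> \<longrightarrow>
      \<Psi> ` L1 T (fscale (fscale sc)) G tG \<nu> \<subseteq> cprod X (\<lambda>x. L1 T (fscale sc) (L x) (\<tau> x) \<nu>) \<and>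
      (\<forall>F \<in> L1 T (fscale (fscale sc)) G tG \<nu>. \<forall>v\<in>D. \<forall>x\<in>X.
        weak_integral T (fscale sc) (L x) (\<tau> x) \<nu> (\<Psi> F x) (v x) =
        weak_integral T (fscale (fscale sc)) G tG \<nu> F v x)"
    using Psi_lin by blast
qed (use hlcs_G G_subset D in auto)

end

theorem theorem2p3p27:
  fixes sc :: "complex \<Rightarrow> 'e::ab_group_add \<Rightarrow> 'e"
    and X :: "'x set"
    and Y :: "'y topology"
    and \<mu> :: "('y \<Rightarrow> complex) \<Rightarrow> complex"
    and E :: "'x \<Rightarrow> 'e set"
    and tE :: "'x \<Rightarrow> 'e topology"
    and QE :: "'x \<Rightarrow> ('e \<Rightarrow> real) set"
    and \<tau> :: "'x \<Rightarrow> ('e \<Rightarrow> 'e) topology"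
    and Q\<tau> :: "'x \<Rightarrow> (('e \<Rightarrow> 'e) \<Rightarrow> real) set"
    and H D :: "('x \<Rightarrow> 'e) set"
    and tH :: "('x \<Rightarrow> 'e) topology"
    and A :: "('x \<Rightarrow> 'e \<Rightarrow> 'e) set"
    and G :: "(('x \<Rightarrow> 'e) \<Rightarrow> 'x \<Rightarrow> 'e) set"
    and tG :: "(('x \<Rightarrow> 'e) \<Rightarrow> 'x \<Rightarrow> 'e) topology"
  assumes "consistent_data sc X Y \<mu> E tE QE \<tau> Q\<tau> H tH A"
    and "G = G_space X E H A"
    and "tG = G_top sc X E \<tau> H A"
    and "D \<subseteq> H"
    and "\<And>x w. x \<in> X \<Longrightarrow> w \<in> Pr x ` D \<Longrightarrow> continuous_map (\<tau> x) (tE x) (\<lambda>f. f w)"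
  shows "(\<forall>F \<in> L1 Y (fscale (fscale sc)) G tG \<mu>. \<forall>x\<in>X.
            Pr x (Psi X E Y F) \<in> L1 Y (fscale sc) (cont_end sc (E x) (tE x)) (\<tau> x) \<mu> \<and>
            (\<forall>v\<in>D.
              weak_integral Y (fscale sc) (cont_end sc (E x) (tE x)) (\<tau> x) \<mu>
                (Pr x (Psi X E Y F)) (v x) =
              weak_integral Y (fscale (fscale sc)) G tG \<mu> F v x))
       \<and> U_space TYPE('t) sc X E tE \<tau> H tH D G tG"
proof -
  interpret consistent_data sc X Y \<mu> E tE QE \<tau> Q\<tau> H tH A by fact
  \<comment> \<open>The integral formula on \<open>Y\<close> is the case \<open>T = Y\<close> and
    \<open>\<nu> = \<mu>\<close> of the lemmas on \<open>Psi\<close>.\<close>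
  show ?thesis
    unfolding assms(2,3)
    using Psi_L1 weak_integral_Psi[OF _ _ subsetD[OF assms(4)]] U_space_G[OF assms(4)]
    by (auto simp: Pr_def)
qed

end
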